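(* Let $n\ge2$ with $n\neq4$. Let $\Gamma$ be a Jordan $\mathcal{C}^1$-sphere in $\mathbb{R}^n$ and let $T$ be a non-flat $n$-simplex in $\mathbb{R}^n$ with vertices $(v_0,\dots,v_n)$. Then there exist a translation $\tau$ and a homothety $\eta$ with positive ratio of $\mathbb{R}^n$ such that $\eta\tau(v_i)\in\Gamma$ for all $i=0,\dots,n$.
   Context: A Jordan $\mathcal{C}^1$-sphere in $\mathbb{R}^n$ is a $\mathcal{C}^1$-submanifold of $\mathbb{R}^n$ diffeomorphic to the standard sphere $S^{n-1}$. An $n$-simplex (ordered $(n+1)$-tuple of points) of $\mathbb{R}^n$ is flat if its vertices are contained in an affine subspace of dimension $n-1$. *)

theory Defs
  imports "HOL-Analysis.Analysis"
begin

text \<open>A Jordan C1-sphere: the image of a C1 embedding of the unit sphere S^(n-1).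
  The map f is C1 on an open neighbourhood U of the sphere (continuous Frechet
  derivative f'), injective on the sphere, and an immersion of the sphere:
  its derivative is injective on every tangent space of the sphere.
  (Compact injective immersions are embeddings, so the image is a C1 submanifold
  diffeomorphic to the standard sphere; conversely any such submanifold arises
  this way.)\<close>
definition jordan_C1_sphere :: "(real^'n) set \<Rightarrow> bool" where
  "jordan_C1_sphere \<Gamma> \<longleftrightarrow>
     (\<exists>(f :: real^'n \<Rightarrow> real^'n) (f' :: real^'n \<Rightarrow> ((real^'n) \<Rightarrow>\<^sub>L (real^'n))) U.
        open U \<and> sphere 0 1 \<subseteq> U \<and>
        (\<forall>x\<in>U. (f has_derivative blinfun_apply (f' x)) (at x)) \<and>
        continuous_on U f' \<and>
        inj_on f (sphere 0 1) \<and>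
        (\<forall>x\<in>sphere 0 1. \<forall>w. w \<bullet> x = 0 \<and> blinfun_apply (f' x) w = 0 \<longrightarrow> w = 0) \<and>
        \<Gamma> = f ` sphere 0 1)"

definition flat_simplex :: "(nat \<Rightarrow> real^'n) \<Rightarrow> bool" where
  "flat_simplex v \<longleftrightarrow>
     (\<exists>S :: (real^'n) set. affine S \<and> aff_dim S = int CARD('n) - 1 \<and>
        (\<forall>i\<le>CARD('n). v i \<in> S))"

definition is_translation :: "(real^'n \<Rightarrow> real^'n) \<Rightarrow> bool" where
  "is_translation \<tau> \<longleftrightarrow> (\<exists>a. \<forall>x. \<tau> x = x + a)"

definition is_pos_homothety :: "(real^'n \<Rightarrow> real^'n) \<Rightarrow> bool" where
  "is_pos_homothety \<eta> \<longleftrightarrow> (\<exists>c r. r > 0 \<and> (\<forall>x. \<eta> x = c + r *\<^sub>R (x - c)))"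

end

theory Submission
  imports Defs "HOL-Homology.Homology"
begin

text \<open>Suppose \<open>\<Gamma> = f ` S\<close> contains no homothet of the simplex, and let \<open>w\<^sub>j = v\<^sub>j - v\<^sub>0\<close>. With \<open>\<Phi>\<close> the
  signed distance to \<open>\<Gamma>\<close>, the vectors \<open>(\<Phi> (f x + r w\<^sub>j))\<^sub>j\<close> are nonzero for all \<open>x \<in> S\<close> and \<open>r > 0\<close>.
  For small \<open>r\<close> they are never opposite to \<open>(\<nu> x \<bullet> w\<^sub>j)\<^sub>j\<close>, a linear isomorphic image of the outer unit
  normal \<open>\<nu> x\<close>, and for large \<open>r\<close> a fixed coordinate is positive; hence \<open>\<nu>\<close> is nullhomotopic.

  A field orthogonal to a nullhomotopic \<open>\<nu>\<close> can be transported along the homotopy from the constant end,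
  so there is a unit field \<open>u\<close> orthogonal to \<open>\<nu>\<close>, that is, \<open>u x = f' x (w x)\<close> with \<open>w\<close> tangent to \<open>S\<close> and
  nowhere zero. Now \<open>\<nu>\<close> is homotopic to \<open>u\<close>, and \<open>u\<close>, being the initial direction of the chords
  of \<open>f\<close> along the great circle leaving \<open>x\<close> in direction \<open>w x\<close>, is homotopic to the full chord
  \<open>f (- x) - f x\<close>. This map is odd, hence essential by Borsuk's theorem: a contradiction.\<close>

section \<open>Borsuk's theorem on odd maps of spheres\<close>

text \<open>Points of \<open>nsphere k\<close> are real sequences, so the basis is numbered to make
  degree theory available in the abstract space.\<close>

locale enumerated_basis =
  fixes b :: "nat \<Rightarrow> 'a::euclidean_space"
  assumes bij_b: "bij_betw b {..<DIM('a)} Basis"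
begin

lemma b_Basis: "i < DIM('a) \<Longrightarrow> b i \<in> Basis"
  using bij_b by (auto simp: bij_betw_def)

lemma inner_b: "i < DIM('a) \<Longrightarrow> j < DIM('a) \<Longrightarrow> b i \<bullet> b j = (if i = j then 1 else 0)"
  using inner_Basis[OF b_Basis b_Basis, of i j] bij_b by (auto simp: bij_betw_def dest: inj_onD)

lemma Basis_cases: assumes "u \<in> Basis" obtains i where "i < DIM('a)" "u = b i"
  using assms bij_b by (auto simp: bij_betw_def image_iff)

section \<open>Coordinate subspheres as copies of the standard spheres\<close>

definition emb :: "(nat \<Rightarrow> real) \<Rightarrow> 'a" where
  "emb x = (\<Sum>i<DIM('a). x i *\<^sub>R b i)"

definition coords :: "'a \<Rightarrow> nat \<Rightarrow> real" where
  "coords y = (\<lambda>i. if i < DIM('a) then y \<bullet> b i else 0)"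

text \<open>For \<open>k < DIM('a)\<close> the span of \<open>b 0, ..., b k\<close>, of dimension
  \<open>k + 1\<close>, so that its unit sphere corresponds to \<open>nsphere k\<close>; for larger
  \<open>k\<close> the whole space.\<close>

definition coord_space :: "nat \<Rightarrow> 'a set" where
  "coord_space k = {y. \<forall>i<DIM('a). k < i \<longrightarrow> y \<bullet> b i = 0}"

abbreviation coord_sphere :: "nat \<Rightarrow> 'a set" where
  "coord_sphere k \<equiv> sphere 0 1 \<inter> coord_space k"

lemma emb_inner: "i < DIM('a) \<Longrightarrow> emb x \<bullet> b i = x i"
  by (simp add: emb_def inner_sum_left inner_b if_distrib cong: if_cong)

lemma emb_coords: "emb (coords y) = y"
proof -
  have "emb (coords y) \<bullet> u = y \<bullet> u" if "u \<in> Basis" for u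
    using that by (elim Basis_cases) (simp add: emb_inner coords_def)
  then show ?thesis by (rule euclidean_eqI)
qed

lemma coords_emb: "(\<And>i. i \<ge> DIM('a) \<Longrightarrow> x i = 0) \<Longrightarrow> coords (emb x) = x"
  by (auto simp: coords_def emb_inner fun_eq_iff)

lemma emb_uminus: "emb (\<lambda>i. - x i) = - emb x"
  by (simp add: emb_def sum_negf)

lemma coords_uminus: "coords (- y) = (\<lambda>i. - coords y i)"
  by (auto simp: coords_def)

lemma norm_emb: "(norm (emb x))\<^sup>2 = (\<Sum>i<DIM('a). (x i)\<^sup>2)"
proof -
  have "(norm (emb x))\<^sup>2 = emb x \<bullet> (\<Sum>i<DIM('a). x i *\<^sub>R b i)"
    by (simp add: power2_norm_eq_inner flip: emb_def)
  also have "\<dots> = (\<Sum>i<DIM('a). (x i)\<^sup>2)"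
    by (simp add: inner_sum_right emb_inner power2_eq_square)
  finally show ?thesis .
qed

lemma subspace_coord_space: "subspace (coord_space k)"
  by (auto simp: coord_space_def subspace_def inner_add_left)

lemma dim_coord_space:
  assumes "k < DIM('a)" shows "dim (coord_space k) = Suc k"
proof -
  have "coord_space k = {x. \<forall>i\<in>Basis. i \<notin> b ` {..k} \<longrightarrow> x \<bullet> i = 0}"
  proof -
    have "i \<in> {..k} \<longleftrightarrow> b i \<in> b ` {..k}" if "i < DIM('a)" for i
      using bij_b that assms by (auto simp: bij_betw_def dest: inj_onD)
    then show ?thesis
      by (fastforce simp: coord_space_def elim: Basis_cases intro: b_Basis)
  qed
  moreover have "b ` {..k} \<subseteq> Basis" using assms by (auto intro: b_Basis)
  moreover have "card (b ` {..k}) = Suc k"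
    using bij_b assms by (subst card_image) (auto simp: bij_betw_def inj_on_def)
  ultimately show ?thesis by (simp add: dim_substandard)
qed

lemma coord_space_mono: "k \<le> l \<Longrightarrow> coord_space k \<subseteq> coord_space l"
  by (auto simp: coord_space_def)

lemma coord_space_top: "DIM('a) \<le> Suc k \<Longrightarrow> coord_space k = UNIV"
  by (auto simp: coord_space_def)

lemma sum_squares_restrict:
  assumes "k < DIM('a)" and "\<And>i. k < i \<Longrightarrow> x i = (0::real)"
  shows "(\<Sum>i\<le>k. (x i)\<^sup>2) = (\<Sum>i<DIM('a). (x i)\<^sup>2)"
  using assms by (intro sum.mono_neutral_left) auto

lemma emb_in_sphere:
  assumes "k < DIM('a)" "x \<in> topspace (nsphere k)" shows "emb x \<in> coord_sphere k"
proof -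
  have x: "(\<Sum>i\<le>k. (x i)\<^sup>2) = 1" "\<And>i. i > k \<Longrightarrow> x i = 0" using assms by (auto simp: nsphere)
  then have "(norm (emb x))\<^sup>2 = 1" using sum_squares_restrict[OF assms(1), of x] norm_emb by simp
  then have "norm (emb x) = 1" by (simp add: power2_eq_1_iff) (metis norm_ge_zero neg_0_le_iff_le not_one_le_zero)
  then show ?thesis using x by (auto simp: coord_space_def emb_inner)
qed

lemma coords_in_nsphere:
  assumes "k < DIM('a)" "y \<in> coord_sphere k" shows "coords y \<in> topspace (nsphere k)"
proof -
  have 0: "\<And>i. i > k \<Longrightarrow> coords y i = 0" using assms by (auto simp: coords_def coord_space_def)
  have "(norm (emb (coords y)))\<^sup>2 = 1" using assms by (simp add: emb_coords)
  then have "(\<Sum>i\<le>k. (coords y i)\<^sup>2) = 1"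
    using sum_squares_restrict[OF assms(1), of "coords y"] 0 norm_emb by simp
  then show ?thesis using 0 by (auto simp: nsphere)
qed

lemma coords_emb_nsphere:
  assumes "k < DIM('a)" "x \<in> topspace (nsphere k)" shows "coords (emb x) = x"
  using assms by (intro coords_emb) (auto simp: nsphere)

lemma continuous_map_emb:
  assumes "k < DIM('a)" shows "continuous_map (nsphere k) (top_of_set (coord_sphere k)) emb"
proof -
  have "continuous_map (nsphere k) euclidean emb"
    unfolding emb_def
  proof (intro continuous_map_sum)
    fix i
    have "continuous_map euclideanreal euclidean (\<lambda>t. t *\<^sub>R b i)"
      by (auto intro!: continuous_intros)
    from continuous_map_compose[OF continuous_map_nsphere_projection this]
    show "continuous_map (nsphere k) euclidean (\<lambda>x. x i *\<^sub>R b i)" by (simp add: o_def)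
  qed auto
  then show ?thesis
    using emb_in_sphere[OF assms] by (auto simp: continuous_map_in_subtopology)
qed

lemma continuous_map_coords:
  assumes "k < DIM('a)" shows "continuous_map (top_of_set (coord_sphere k)) (nsphere k) coords"
proof -
  have "continuous_map (top_of_set (coord_sphere k)) (powertop_real UNIV) coords"
    unfolding continuous_map_componentwise_UNIV coords_def by (auto intro!: continuous_intros)
  then show ?thesis
    using coords_in_nsphere[OF assms] unfolding nsphere 
    by (auto simp: continuous_map_in_subtopology)
qed

section \<open>Degree of self-maps of coordinate subspheres\<close>

definition sphere_degree :: "nat \<Rightarrow> ('a \<Rightarrow> 'a) \<Rightarrow> int" where
  "sphere_degree k f = Brouwer_degree2 k (coords \<circ> f \<circ> emb)"

lemma continuous_map_conj:
  assumes "k < DIM('a)" "continuous_on (coord_sphere k) f" "f ` coord_sphere k \<subseteq> coord_sphere k"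
  shows "continuous_map (nsphere k) (nsphere k) (coords \<circ> f \<circ> emb)"
  using assms
  by (intro continuous_map_compose[OF continuous_map_emb]
    continuous_map_compose[OF _ continuous_map_coords]) auto

lemma sphere_degree_homotopic:
  assumes "k < DIM('a)" "homotopic_with_canon (\<lambda>_. True) (coord_sphere k) (coord_sphere k) f g"
  shows "sphere_degree k f = sphere_degree k g"
  unfolding sphere_degree_def
  by (intro Brouwer_degree2_homotopic homotopic_with_compose_continuous_map_right
     [OF homotopic_with_compose_continuous_map_left continuous_map_emb])
    (use assms continuous_map_coords in auto)

lemma sphere_degree_cong:
  assumes "k < DIM('a)" "continuous_on (coord_sphere k) f" "f ` coord_sphere k \<subseteq> coord_sphere k"
    "\<And>x. x \<in> coord_sphere k \<Longrightarrow> f x = g x"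
  shows "sphere_degree k f = sphere_degree k g"
  by (intro sphere_degree_homotopic homotopic_with_equal) (use assms in auto)

lemma sphere_degree_compose:
  assumes "k < DIM('a)" "continuous_on (coord_sphere k) f" "f ` coord_sphere k \<subseteq> coord_sphere k"
    "continuous_on (coord_sphere k) g" "g ` coord_sphere k \<subseteq> coord_sphere k"
  shows "sphere_degree k (g \<circ> f) = sphere_degree k g * sphere_degree k f"
  using Brouwer_degree2_compose[OF continuous_map_conj[OF assms(1-3)] continuous_map_conj[OF assms(1,4,5)]]
  by (simp add: sphere_degree_def o_def emb_coords)

lemma sphere_degree_id: 
  assumes "k < DIM('a)" shows "sphere_degree k id = 1"
proof -
  have "Brouwer_degree2 k (coords \<circ> id \<circ> emb) = Brouwer_degree2 k id"
    by (intro Brouwer_degree2_homotopic homotopic_with_equal continuous_map_conj)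
      (use assms coords_emb_nsphere in auto)
  then show ?thesis by (simp add: sphere_degree_def)
qed

text \<open>The square of the degree is the degree of the identity, which is 1.\<close>

lemma odd_sphere_degree_involution:
  assumes "k < DIM('a)" "continuous_on (coord_sphere k) f" "f ` coord_sphere k \<subseteq> coord_sphere k"
    "\<And>x. x \<in> coord_sphere k \<Longrightarrow> f (f x) = x"
  shows "odd (sphere_degree k f)"
proof -
  have "sphere_degree k f * sphere_degree k f = sphere_degree k (f \<circ> f)"
    using sphere_degree_compose[OF assms(1-3,2-3)] by simp
  also have "\<dots> = sphere_degree k id"
  proof (rule sphere_degree_cong)
    show "continuous_on (coord_sphere k) (f \<circ> f)"
      using assms(2,3) by (intro continuous_on_compose) (auto intro: continuous_on_subset)
    show "(f \<circ> f) ` coord_sphere k \<subseteq> coord_sphere k"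
      using assms(3) unfolding image_comp[symmetric] by blast
  qed (use assms in auto)
  also have "\<dots> = 1" using assms by (simp add: sphere_degree_id)
  finally show ?thesis by (metis even_mult_iff odd_one)
qed

lemma sphere_degree_const: "sphere_degree k (\<lambda>x. c) = 0"
  using Brouwer_degree2_const by (simp add: sphere_degree_def o_def)

text \<open>The inductive step of Borsuk's theorem, carried over from \<open>nsphere\<close>:
  \<open>emb\<close> and \<open>coords\<close> commute with the antipodal map, so oddness survives
  the transport.\<close>

lemma sphere_degree_parity_step:
  assumes k: "Suc k < DIM('a)" and f: "continuous_on (coord_sphere (Suc k)) f"
    "f ` coord_sphere (Suc k) \<subseteq> coord_sphere (Suc k)" "f ` coord_sphere k \<subseteq> coord_sphere k"
    and odd: "\<And>x. x \<in> coord_sphere (Suc k) \<Longrightarrow> f (- x) = - f x"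
  shows "even (sphere_degree (Suc k) f - sphere_degree k f)"
proof -
  have "even (Brouwer_degree2 (Suc k) (coords \<circ> f \<circ> emb) - Brouwer_degree2 (Suc k - Suc 0) (coords \<circ> f \<circ> emb))"
  proof (rule Borsuk_odd_mapping_degree_step)
    show "continuous_map (nsphere (Suc k)) (nsphere (Suc k)) (coords \<circ> f \<circ> emb)"
      by (rule continuous_map_conj[OF k f(1,2)])
    fix u assume "u \<in> topspace (nsphere (Suc k))"
    then have "emb u \<in> coord_sphere (Suc k)" using emb_in_sphere[OF k] by blast
    then show "(coords \<circ> f \<circ> emb \<circ> (\<lambda>x i. - x i)) u = ((\<lambda>x i. - x i) \<circ> (coords \<circ> f \<circ> emb)) u"
      using odd by (simp add: emb_uminus coords_uminus)
  next
    show "coords \<circ> f \<circ> emb \<in> topspace (nsphere (Suc k - Suc 0)) \<rightarrow> topspace (nsphere (Suc k - Suc 0))"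
      using coords_in_nsphere[of k] emb_in_sphere[of k] f(3) k by (auto simp: Suc_lessD image_subset_iff)
  qed
  then show ?thesis by (simp add: sphere_degree_def)
qed

section \<open>Odd maps and the equator\<close>

lemma coord_sphere_mono: "k \<le> l \<Longrightarrow> coord_sphere k \<subseteq> coord_sphere l"
  using coord_space_mono by blast

lemma uminus_coord_sphere: "x \<in> coord_sphere k \<Longrightarrow> - x \<in> coord_sphere k"
  by (simp add: subspace_coord_space subspace_neg)

text \<open>The straight-line homotopy stays in the subspace by convexity and misses 0 by
  \<open>seg\<close>. Radial projection returns it to the sphere and fixes the unit vectors
  \<open>f x\<close>.\<close>

lemma homotopic_normalized:
  assumes f: "continuous_on (coord_sphere k) f" "f ` coord_sphere k \<subseteq> coord_sphere k"
    and g: "continuous_on (coord_sphere k) g" "g ` coord_sphere k \<subseteq> coord_space k"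
    and seg: "\<And>x. x \<in> coord_sphere k \<Longrightarrow> 0 \<notin> closed_segment (f x) (g x)"
  shows "homotopic_with_canon (\<lambda>_. True) (coord_sphere k) (coord_sphere k) f (\<lambda>x. g x /\<^sub>R norm (g x))"
proof -
  have "closed_segment (f x) (g x) \<subseteq> coord_space k - {0}" if "x \<in> coord_sphere k" for x
  proof -
    have "f x \<in> coord_space k" "g x \<in> coord_space k" using f(2) g(2) that by blast+
    then show ?thesis
      using seg[OF that] closed_segment_subset subspace_imp_convex[OF subspace_coord_space] by blast
  qed
  then have "homotopic_with_canon (\<lambda>_. True) (coord_sphere k) (coord_space k - {0}) f g"
    by (intro homotopic_with_linear f g)
  then have "homotopic_with_canon (\<lambda>_. True) (coord_sphere k) (coord_sphere k)
      ((\<lambda>y. y /\<^sub>R norm y) \<circ> f) ((\<lambda>y. y /\<^sub>R norm y) \<circ> g)"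
    by (rule homotopic_with_compose_continuous_left)
      (auto intro!: continuous_intros subspace_scale[OF subspace_coord_space])
  then show ?thesis
    by (rule homotopic_with_eq) (use f(2) in \<open>auto simp: image_subset_iff\<close>)
qed

text \<open>A merely continuous map might cover the whole sphere already on the equator
  \<open>coord_sphere k\<close>. A differentiable one cannot raise dimension in this way, so
  \<open>f\<close> is approximated by a normalized odd polynomial map.\<close>

lemma odd_map_misses_point:
  assumes k: "Suc k < DIM('a)" and f: "continuous_on (coord_sphere (Suc k)) f"
    "f ` coord_sphere (Suc k) \<subseteq> coord_sphere (Suc k)"
    and odd: "\<And>x. x \<in> coord_sphere (Suc k) \<Longrightarrow> f (- x) = - f x"
  obtains g a where "continuous_on (coord_sphere (Suc k)) g" "g ` coord_sphere (Suc k) \<subseteq> coord_sphere (Suc k)"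
    "\<And>x. x \<in> coord_sphere (Suc k) \<Longrightarrow> g (- x) = - g x"
    "homotopic_with_canon (\<lambda>_. True) (coord_sphere (Suc k)) (coord_sphere (Suc k)) f g"
    "a \<in> coord_sphere (Suc k)" "a \<notin> g ` coord_sphere k"
proof -
  let ?S = "coord_sphere (Suc k)"
  have clo: "closed (coord_space (Suc k))" by (rule closed_subspace[OF subspace_coord_space])
  obtain p where p: "polynomial_function p" "p ` ?S \<subseteq> coord_space (Suc k)"
      "\<And>x. x \<in> ?S \<Longrightarrow> norm (f x - p x) < 1"
    using Stone_Weierstrass_polynomial_function_subspace[of ?S f 1 "coord_space (Suc k)"]
      f subspace_coord_space compact_Int_closed[OF compact_sphere clo] by auto
  \<comment> \<open>The odd part of \<open>p\<close>; since \<open>f\<close> is odd, it still lies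
    within distance 1 of \<open>f\<close>.\<close>
  define q where "q x = (1/2) *\<^sub>R (p x - p (- x))" for x
  have q_sub: "q ` ?S \<subseteq> coord_space (Suc k)"
    using p(2) uminus_coord_sphere
    by (fastforce simp: q_def image_subset_iff intro!: subspace_scale[OF subspace_coord_space] subspace_diff[OF subspace_coord_space])
  have close: "norm (f x - q x) < 1" if "x \<in> ?S" for x
  proof -
    have "f x - q x = (1/2) *\<^sub>R ((f x - p x) - (f (- x) - p (- x)))"
      using odd[OF that] by (simp add: q_def algebra_simps flip: scaleR_2)
    then have "norm (f x - q x) \<le> (1/2) * (norm (f x - p x) + norm (f (- x) - p (- x)))"
      by (simp add: norm_triangle_ineq4)
    then show ?thesis using p(3)[OF that] p(3)[OF uminus_coord_sphere[OF that]] by simp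
  qed
  \<comment> \<open>The whole segment lies within distance less than 1 of the unit vector
    \<open>f x\<close>.\<close>
  have q0: "0 \<notin> closed_segment (f x) (q x)" if "x \<in> ?S" for x
  proof
    assume "0 \<in> closed_segment (f x) (q x)"
    then have "norm (f x - 0) \<le> norm (f x - q x)"
      using segment_bound(1)[of 0 "f x" "q x"] by (simp add: norm_minus_commute)
    then show False using close[OF that] f(2) that by (auto simp: image_subset_iff)
  qed
  then have qn: "q x \<noteq> 0" if "x \<in> ?S" for x using that by force
  have p_diff: "p differentiable_on A" for A
    using p(1) by (simp add: differentiable_on_polynomial_function)
  have q_diff: "q differentiable_on A" for A
    unfolding q_def
    by (intro differentiable_on_scaleR differentiable_on_diff differentiable_on_const p_diff
       differentiable_on_compose[OF differentiable_on_minus[OF differentiable_on_ident], unfolded o_def])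
  have q_cont: "continuous_on A q" for A by (rule differentiable_imp_continuous_on[OF q_diff])
  define g where "g x = q x /\<^sub>R norm (q x)" for x
  have hom: "homotopic_with_canon (\<lambda>_. True) ?S ?S f g"
    unfolding g_def by (intro homotopic_normalized f q_cont q_sub q0)
  have g: "continuous_on ?S g" "g ` ?S \<subseteq> ?S"
    using homotopic_with_imp_continuous[OF hom] homotopic_with_imp_subset2[OF hom] by auto
  have g_odd: "g (- x) = - g x" if "x \<in> ?S" for x
  proof -
    have "q (- x) = - q x" by (simp add: q_def algebra_simps)
    then show ?thesis by (simp add: g_def)
  qed
  have "g differentiable_on coord_sphere k"
    unfolding g_def
  proof (intro differentiable_on_scaleR differentiable_on_inverse q_diff)
    have "norm differentiable_on q ` coord_sphere k"
      using qn coord_sphere_mono[of k "Suc k"] by (intro differentiable_on_norm) fastforce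
    then show "(\<lambda>x. norm (q x)) differentiable_on coord_sphere k"
      using differentiable_on_compose[OF q_diff, of norm] by (simp add: o_def)
  qed (use qn coord_sphere_mono[of k "Suc k"] in fastforce)
  then have "g ` coord_sphere k \<noteq> ?S"
    using k by (intro spheremap_lemma1 subspace_coord_space coord_space_mono) (auto simp: dim_coord_space)
  moreover have "g ` coord_sphere k \<subseteq> ?S" using g(2) coord_sphere_mono[of k "Suc k"] by auto
  ultimately obtain a where "a \<in> ?S" "a \<notin> g ` coord_sphere k" by blast
  then show ?thesis using that g g_odd hom by blast
qed

text \<open>The reflection in the hyperplane orthogonal to \<open>a - c\<close> exchanges two
  vectors of equal norm; if \<open>a = c\<close>, then \<open>u = 0\<close> and \<open>R\<close> is
  the identity.\<close>

lemma exists_sphere_reflection: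
  assumes k: "k < DIM('a)" and a: "a \<in> coord_sphere k" and c: "c \<in> coord_sphere k"
  obtains R where "linear R" "\<And>x. norm (R x) = norm x" "R ` coord_space k \<subseteq> coord_space k"
    "\<And>x. R (R x) = x" "R a = c"
proof -
  define u where "u = a - c"
  define R where "R x = x - (2 * (x \<bullet> u) / (u \<bullet> u)) *\<^sub>R u" for x
  have lin: "linear R"
    by (rule linearI) (simp_all add: R_def inner_add_left algebra_simps add_divide_distrib)
  have dot: "R x \<bullet> u = - (x \<bullet> u)" for x
    by (cases "u = 0") (auto simp: R_def inner_diff_left)
  have inv: "R (R x) = x" for x
    unfolding R_def[of "R x"] dot by (simp add: R_def)
  have norm_R: "norm (R x) = norm x" for x
  proof -
    have "R x \<bullet> R x = R x \<bullet> x - (2 * (x \<bullet> u) / (u \<bullet> u)) * (R x \<bullet> u)"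
      by (subst (2) R_def) (simp only: inner_diff_right inner_scaleR_right)
    also have "\<dots> = x \<bullet> x"
      unfolding dot by (simp add: R_def inner_diff_left inner_diff_right inner_commute)
    finally show ?thesis by (simp add: norm_eq_sqrt_inner)
  qed
  have "u \<in> coord_space k"
    using a c by (auto simp: u_def intro: subspace_diff[OF subspace_coord_space])
  then have sub: "R ` coord_space k \<subseteq> coord_space k"
    unfolding R_def
    by (auto intro!: subspace_diff[OF subspace_coord_space] subspace_scale[OF subspace_coord_space])
  have "R a = c"
  proof (cases "u = 0")
    case False
    have "a \<bullet> a = 1" "c \<bullet> c = 1" using a c by (auto simp: norm_eq_sqrt_inner)
    then have "u \<bullet> u = 2 * (a \<bullet> u)"
      by (simp add: u_def inner_diff_left inner_diff_right inner_commute)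
    moreover have "u \<bullet> u \<noteq> 0" using False by simp
    ultimately have "2 * (a \<bullet> u) / (u \<bullet> u) = 1" by (metis divide_self)
    then have "R a = a - 1 *\<^sub>R u" by (simp only: R_def)
    then show ?thesis by (simp add: u_def)
  qed (simp add: R_def u_def)
  with that lin norm_R sub inv show ?thesis by blast
qed

text \<open>Induction on the dimension. Up to a reflection, an odd map is homotopic to an odd map
  preserving the equator, whose degree has the parity of its degree on the equator. In dimension 0
  the sphere is a pair of antipodes, on which an odd map is an involution.\<close>

theorem Borsuk_odd_degree:
  assumes "k < DIM('a)" "continuous_on (coord_sphere k) f" "f ` coord_sphere k \<subseteq> coord_sphere k"
    "\<And>x. x \<in> coord_sphere k \<Longrightarrow> f (- x) = - f x"
  shows "odd (sphere_degree k f)"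
  using assms
proof (induction k arbitrary: f)
  case 0
  have S: "x = b 0 \<or> x = - b 0" if "x \<in> coord_sphere 0" for x
  proof -
    have x0: "coords x i = 0" if "i > 0" for i using \<open>x \<in> _\<close> that by (auto simp: coords_def coord_space_def)
    then have "emb (coords x) = (x \<bullet> b 0) *\<^sub>R b 0"
      unfolding emb_def
      by (subst sum.mono_neutral_right[of _ "{0}"]) (use x0 in \<open>auto simp: coords_def[of x, THEN fun_cong, of 0]\<close>)
    then have x: "x = (x \<bullet> b 0) *\<^sub>R b 0" by (simp add: emb_coords)
    moreover have "norm x = 1" "norm (b 0) = 1" using \<open>x \<in> _\<close> b_Basis[of 0] by auto
    ultimately have "\<bar>x \<bullet> b 0\<bar> = 1" by (metis mult.right_neutral norm_scaleR)
    then have "x \<bullet> b 0 = 1 \<or> x \<bullet> b 0 = - 1" by linarith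
    then show ?thesis using x by (metis scaleR_minus1_left scaleR_one)
  qed
  show ?case
  proof (rule odd_sphere_degree_involution)
    fix x assume x: "x \<in> coord_sphere 0"
    have "f x \<in> coord_sphere 0" using x 0(3) by blast
    from S[OF this] S[OF x] have "f x = x \<or> f x = - x" by auto
    then show "f (f x) = x" using 0(4)[OF x] by auto
  qed (use 0 in auto)
next
  case (Suc k)
  let ?S = "coord_sphere (Suc k)" and ?e = "b (Suc k)"
  obtain g a where g: "continuous_on ?S g" "g ` ?S \<subseteq> ?S" "\<And>x. x \<in> ?S \<Longrightarrow> g (- x) = - g x"
    and fg: "homotopic_with_canon (\<lambda>_. True) ?S ?S f g" and a: "a \<in> ?S" "a \<notin> g ` coord_sphere k"
    using odd_map_misses_point[OF Suc.prems] by blast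
  have e: "?e \<in> ?S" using Suc.prems(1) b_Basis by (auto simp: coord_space_def inner_b)
  \<comment> \<open>The missed point is moved to the pole, in the direction of the coordinate that
    is to be removed on the equator.\<close>
  obtain R where R: "linear R" "\<And>x. norm (R x) = norm x" "R ` coord_space (Suc k) \<subseteq> coord_space (Suc k)"
    "\<And>x. R (R x) = x" "R a = ?e"
    using exists_sphere_reflection[OF Suc.prems(1) a(1) e] by blast
  have RS: "continuous_on A R" "R ` ?S \<subseteq> ?S" for A
    using R linear_continuous_on[of R] by (auto simp: linear_conv_bounded_linear)
  define h where "h = R \<circ> g"
  have h: "continuous_on ?S h" "h ` ?S \<subseteq> ?S"
    using g(2) RS(2) unfolding h_def image_comp[symmetric]
    by (blast intro: continuous_on_compose g(1) RS(1))+
  have h_odd: "h (- x) = - h x" if "x \<in> ?S" for x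
    using g(3)[OF that] linear_neg[OF R(1)] by (simp add: h_def)
  have h_miss: "h x \<noteq> ?e" "h x \<noteq> - ?e" if "x \<in> coord_sphere k" for x
  proof -
    have *: "h y \<noteq> ?e" if "y \<in> coord_sphere k" for y
    proof
      assume "h y = ?e"
      then have "g y = a" using R(4,5) by (metis comp_apply h_def)
      then show False using a that by blast
    qed
    show "h x \<noteq> ?e" using * that by blast
    \<comment> \<open>By oddness, taking the value \<open>- ?e\<close> at \<open>x\<close> would
      mean taking \<open>?e\<close> at \<open>- x\<close>, again on the equator.\<close>
    show "h x \<noteq> - ?e"
      using *[OF uminus_coord_sphere[OF that]] h_odd[of x] that coord_sphere_mono[of k "Suc k"] by auto
  qed
  txt \<open>The even cutoff \<open>1 - \<bar>x \<bullet> ?e\<bar>\<close> equals 1 only on the equator, where \<open>h\<close> avoids the poles: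
    so \<open>m\<close> is odd, never vanishes, and maps the equator into its own hyperplane.\<close>
  define m where "m x = h x - ((1 - \<bar>x \<bullet> ?e\<bar>) * (h x \<bullet> ?e)) *\<^sub>R ?e" for x
  define l where "l x = m x /\<^sub>R norm (m x)" for x
  have seg: "0 \<notin> closed_segment (h x) (m x)" if x: "x \<in> ?S" for x
  proof
    assume "0 \<in> closed_segment (h x) (m x)"
    then obtain u where u: "0 \<le> u" "u \<le> 1" "0 = (1 - u) *\<^sub>R h x + u *\<^sub>R m x"
      by (auto simp: closed_segment_def)
    \<comment> \<open>A zero on the segment makes \<open>h x\<close> equal to \<open>s\<close> times
      its component along \<open>?e\<close>. As \<open>h x\<close> is nonzero, \<open>s = 1\<close>;
      this puts \<open>x\<close> on the equator and \<open>h x\<close> at a pole, which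
      \<open>h_miss\<close> excludes.\<close>
    define s where "s = u * (1 - \<bar>x \<bullet> ?e\<bar>)"
    have hx: "h x = (s * (h x \<bullet> ?e)) *\<^sub>R ?e" using u(3) by (simp add: m_def s_def algebra_simps)
    then have "h x \<bullet> ?e = s * (h x \<bullet> ?e)" using Suc.prems(1)
      by (metis inner_b inner_scaleR_left mult.right_neutral)
    moreover have hS: "h x \<in> ?S" using h(2) x by blast
    then have "h x \<noteq> 0" by auto
    ultimately have "s = 1" using hx by auto
    moreover have "s \<le> 1 - \<bar>x \<bullet> ?e\<bar>"
    proof -
      have "\<bar>x \<bullet> ?e\<bar> \<le> 1" using Cauchy_Schwarz_ineq2[of x ?e] x e by auto
      then show ?thesis using u mult_right_mono[of u 1 "1 - \<bar>x \<bullet> ?e\<bar>"] by (simp add: s_def)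
    qed
    ultimately have "x \<bullet> ?e = 0" by auto
    then have "x \<in> coord_sphere k"
      using x by (auto simp: coord_space_def) (metis Suc_lessI)
    moreover have "h x = (h x \<bullet> ?e) *\<^sub>R ?e" using hx \<open>s = 1\<close> by simp
    moreover have "norm (h x) = 1" "norm ?e = 1" using hS e by auto
    ultimately have "\<bar>h x \<bullet> ?e\<bar> = 1" by (metis mult.right_neutral norm_scaleR)
    then have "h x = ?e \<or> h x = - ?e" using \<open>h x = (h x \<bullet> ?e) *\<^sub>R ?e\<close>
      by (metis abs_eq_iff abs_1 scaleR_minus1_left scaleR_one)
    then show False using h_miss[OF \<open>x \<in> coord_sphere k\<close>] by blast
  qed
  have m: "continuous_on ?S m" "m ` ?S \<subseteq> coord_space (Suc k)"
    unfolding m_def using h e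
    by (auto intro!: continuous_intros subspace_diff[OF subspace_coord_space] subspace_scale[OF subspace_coord_space])
  have hl: "homotopic_with_canon (\<lambda>_. True) ?S ?S h l"
    unfolding l_def by (intro homotopic_normalized h m seg)
  have l: "continuous_on ?S l" "l ` ?S \<subseteq> ?S"
    using homotopic_with_imp_continuous[OF hl] homotopic_with_imp_subset2[OF hl] by auto
  have l_odd: "l (- x) = - l x" if "x \<in> ?S" for x
  proof -
    have "m (- x) = - m x" using h_odd[OF that] by (simp add: m_def)
    then show ?thesis by (simp add: l_def)
  qed
  have l_eq: "l ` coord_sphere k \<subseteq> coord_sphere k"
  proof clarify
    fix x assume x: "x \<in> sphere 0 1" "x \<in> coord_space k"
    then have xS: "x \<in> ?S" using coord_sphere_mono[of k "Suc k"] by auto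
    have "x \<bullet> ?e = 0" using x Suc.prems(1) by (auto simp: coord_space_def)
    then have "m x \<bullet> ?e = 0" using inner_b[OF Suc.prems(1) Suc.prems(1)] by (simp add: m_def inner_diff_left)
    moreover have "l x \<in> ?S" using l(2) xS by blast
    ultimately show "l x \<in> coord_sphere k"
      unfolding coord_space_def by (auto simp: l_def) (metis Suc_lessI)
  qed
  have "odd (sphere_degree k l)"
    using Suc.prems(1) l l_eq l_odd coord_sphere_mono[of k "Suc k"]
    by (intro Suc.IH) (auto intro: continuous_on_subset)
  then have "odd (sphere_degree (Suc k) l)"
    using sphere_degree_parity_step[OF Suc.prems(1) l l_eq l_odd] by auto
  then have "odd (sphere_degree (Suc k) h)"
    using sphere_degree_homotopic[OF Suc.prems(1) hl] by simp
  \<comment> \<open>The degree of \<open>h\<close> is the product of those of \<open>R\<close> and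
    \<open>g\<close>, and factors of an odd product are odd.\<close>
  then have "odd (sphere_degree (Suc k) g)"
    unfolding h_def by (simp add: sphere_degree_compose[OF Suc.prems(1) g(1,2) RS])
  then show ?case
    using sphere_degree_homotopic[OF Suc.prems(1) fg] by simp
qed

end

text \<open>After normalization \<open>f\<close> has odd degree on the top coordinate sphere, while
  a constant has degree 0.\<close>

theorem odd_map_not_nullhomotopic:
  fixes f :: "'a::euclidean_space \<Rightarrow> 'a"
  assumes odd: "\<And>x. x \<in> sphere 0 1 \<Longrightarrow> f (- x) = - f x"
    and hom: "homotopic_with_canon (\<lambda>_. True) (sphere 0 1) (- {0}) f (\<lambda>x. c)"
  shows False
proof -
  obtain b :: "nat \<Rightarrow> 'a" where "bij_betw b {..<DIM('a)} Basis"
    using ex_bij_betw_nat_finite[OF finite_Basis] by (auto simp: atLeast0LessThan)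
  then interpret enumerated_basis b by unfold_locales
  define k where "k = DIM('a) - 1"
  have k: "k < DIM('a)" by (simp add: k_def)
  have S: "coord_sphere k = sphere 0 1" using coord_space_top[of k] by (simp add: k_def)
  let ?n = "\<lambda>y::'a. y /\<^sub>R norm y"
  have *: "homotopic_with_canon (\<lambda>_. True) (sphere 0 1) (sphere 0 1) (?n \<circ> f) (?n \<circ> (\<lambda>x. c))"
    by (rule homotopic_with_compose_continuous_left[OF hom]) (auto intro!: continuous_intros)
  have "odd (sphere_degree k (?n \<circ> f))"
    using homotopic_with_imp_continuous[OF *] homotopic_with_imp_subset1[OF *] odd
    by (intro Borsuk_odd_degree k) (auto simp: S)
  moreover have "sphere_degree k (?n \<circ> f) = sphere_degree k (?n \<circ> (\<lambda>x. c))"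
    using * by (intro sphere_degree_homotopic k) (simp add: S)
  ultimately show False using sphere_degree_const[of k "?n c"] by (simp add: o_def)
qed

section \<open>Fields orthogonal to a nullhomotopic map\<close>

text \<open>Project \<open>u\<close> off \<open>h\<close> and normalize. The projection can vanish
  only where \<open>u x\<close> is parallel to \<open>h x\<close>; there \<open>g x\<close> and
  \<open>h x\<close> would be orthogonal unit vectors, at distance sqrt 2.\<close>

lemma orthogonal_field_perturb:
  fixes u g h :: "'a::topological_space \<Rightarrow> 'b::real_inner"
  assumes u: "continuous_on S u" "u ` S \<subseteq> sphere 0 1" and h: "continuous_on S h" "h ` S \<subseteq> sphere 0 1"
    and g: "g ` S \<subseteq> sphere 0 1"
    and orth: "\<And>x. x \<in> S \<Longrightarrow> u x \<bullet> g x = 0" and close: "\<And>x. x \<in> S \<Longrightarrow> norm (g x - h x) < 1"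
  shows "\<exists>v. continuous_on S v \<and> v ` S \<subseteq> sphere 0 1 \<and> (\<forall>x\<in>S. v x \<bullet> h x = 0)"
proof -
  define w where "w x = u x - (u x \<bullet> h x) *\<^sub>R h x" for x
  have w0: "w x \<noteq> 0" if x: "x \<in> S" for x
  proof
    have n: "u x \<bullet> u x = 1" "g x \<bullet> g x = 1" "h x \<bullet> h x = 1"
      using u(2) g h(2) x by (auto simp: image_subset_iff norm_eq_1)
    assume "w x = 0"
    then have eq: "u x = (u x \<bullet> h x) *\<^sub>R h x" by (simp add: w_def)
    then have "(u x \<bullet> h x) * (h x \<bullet> g x) = 0" using orth[OF x] by (metis inner_scaleR_left)
    moreover have "u x \<bullet> h x \<noteq> 0" using eq n(1) by auto
    ultimately have "g x \<bullet> h x = 0" by (simp add: inner_commute)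
    then have "(norm (g x - h x))\<^sup>2 = 2"
      by (simp add: power2_norm_eq_inner inner_diff_left inner_diff_right inner_commute n)
    moreover have "(norm (g x - h x))\<^sup>2 < 1\<^sup>2" using close[OF x] by (intro power_strict_mono) auto
    ultimately show False by simp
  qed
  have "w x \<bullet> h x = 0" if "x \<in> S" for x
    using h(2) that by (auto simp: w_def inner_diff_left image_subset_iff norm_eq_1)
  moreover have "continuous_on S w" unfolding w_def by (intro continuous_intros u h)
  ultimately show ?thesis using w0
    by (intro exI[of _ "\<lambda>x. w x /\<^sub>R norm (w x)"]) (auto intro!: continuous_intros)
qed

text \<open>Uniform continuity cuts the homotopy into \<open>N\<close> stages, each moving every
  value by less than 1, and \<open>orthogonal_field_perturb\<close> carries the field across one
  stage.\<close>

lemma nullhomotopic_imp_orthogonal_field: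
  fixes g :: "'a::euclidean_space \<Rightarrow> 'b::euclidean_space"
  assumes "compact S" "2 \<le> DIM('b)"
    and "homotopic_with_canon (\<lambda>_. True) S (sphere 0 1) g (\<lambda>x. c)"
  obtains u where "continuous_on S u" "u ` S \<subseteq> sphere 0 1" "\<And>x. x \<in> S \<Longrightarrow> u x \<bullet> g x = 0"
proof -
  obtain h :: "real \<times> 'a \<Rightarrow> 'b" where h: "continuous_on ({0..1} \<times> S) h" "h ` ({0..1} \<times> S) \<subseteq> sphere 0 1"
    "\<And>x. x \<in> S \<Longrightarrow> h (0, x) = g x" "\<And>x. x \<in> S \<Longrightarrow> h (1, x) = c"
    using assms(3) by (auto simp: homotopic_with)
  have "uniformly_continuous_on ({0..1} \<times> S) h"
    by (intro compact_uniformly_continuous h compact_Times assms) auto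
  then obtain d where d: "d > 0" "\<And>p q. p \<in> {0..1} \<times> S \<Longrightarrow> q \<in> {0..1} \<times> S \<Longrightarrow> dist q p < d \<Longrightarrow> dist (h q) (h p) < 1"
    unfolding uniformly_continuous_on_def by (metis zero_less_one)
  obtain N :: nat where N: "N > 0" "inverse (real N) < d"
    using d(1) by (metis ex_inverse_of_nat_less)
  define F where "F s \<longleftrightarrow> (\<exists>v. continuous_on S v \<and> v ` S \<subseteq> sphere 0 1 \<and> (\<forall>x\<in>S. v x \<bullet> h (s, x) = 0))" for s
  have sec: "continuous_on S (\<lambda>x. h (s, x))" "(\<lambda>x. h (s, x)) ` S \<subseteq> sphere 0 1" if "s \<in> {0..1}" for s
    using that h(2) by (auto intro!: continuous_on_compose2[OF h(1)] continuous_intros)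
  \<comment> \<open>\<open>k\<close> counts stages backwards from the constant end at time 1, where
    one vector orthogonal to \<open>c\<close> serves for all \<open>x\<close>, to time 0, where the
    map is \<open>g\<close>.\<close>
  have "F (1 - real k / real N)" if "k \<le> N" for k
    using that
  proof (induction k)
    case 0
    obtain e where "e \<noteq> 0" "c \<bullet> e = 0"
      using orthogonal_to_vector_exists[OF assms(2), of c] by (auto simp: orthogonal_def)
    then show ?case using h(4)
      by (auto simp: F_def inner_commute intro!: exI[of _ "\<lambda>x. e /\<^sub>R norm e"])
  next
    case (Suc k)
    let ?s = "1 - real k / real N" and ?t = "1 - real (Suc k) / real N"
    have st: "?s \<in> {0..1}" "?t \<in> {0..1}" using Suc.prems N by (auto simp: field_simps)
    from Suc obtain u where u: "continuous_on S u" "u ` S \<subseteq> sphere 0 1" "\<And>x. x \<in> S \<Longrightarrow> u x \<bullet> h (?s, x) = 0"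
      unfolding F_def by auto
    have "norm (h (?s, x) - h (?t, x)) < 1" if "x \<in> S" for x
    proof -
      have "?s - ?t = inverse (real N)" using N(1) by (simp add: field_simps)
      moreover have "dist (?s, x) (?t, x) = \<bar>?s - ?t\<bar>" by (simp only: dist_Pair_Pair dist_real_def) simp
      ultimately have "dist (?s, x) (?t, x) = inverse (real N)" by simp
      then show ?thesis using d(2)[of "(?t, x)" "(?s, x)"] st that N by (simp add: dist_norm)
    qed
    then show ?case unfolding F_def by (intro orthogonal_field_perturb[OF u(1,2) _ _ _ u(3)] sec st)
  qed
  from this[of N] N have "F 0" by simp
  then show ?thesis using that h(3) by (auto simp: F_def)
qed

text \<open>A closed graph theorem; it gives continuity of fields that are obtained pointwise but
  uniquely determined.\<close>

lemma continuous_on_image_compact_graph: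
  fixes f :: "'a::euclidean_space \<Rightarrow> 'b::euclidean_space"
  assumes "compact G" and "\<And>x y. x \<in> S \<Longrightarrow> (x, y) \<in> G \<longleftrightarrow> y = f x" and "fst ` G \<subseteq> S"
  shows "continuous_on S f"
proof -
  have *: "(\<lambda>x. (x, f x)) ` S = G" using assms(2,3) by (force simp: image_iff)
  have "f \<in> S \<rightarrow> snd ` G" using * by force
  then show ?thesis
    using assms(1) by (intro continuous_from_closed_graph[of "snd ` G"])
     (auto simp: * compact_imp_closed intro!: compact_continuous_image continuous_intros)
qed

section \<open>Immersed spheres and their normals\<close>

locale C1_immersed_sphere =
  fixes f :: "'a::euclidean_space \<Rightarrow> 'a" and f' :: "'a \<Rightarrow> 'a \<Rightarrow>\<^sub>L 'a" and U :: "'a set"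
  assumes open_U: "open U" and sphere_U: "sphere 0 1 \<subseteq> U"
    and deriv: "\<And>x. x \<in> U \<Longrightarrow> (f has_derivative blinfun_apply (f' x)) (at x)"
    and cont_deriv: "continuous_on U f'"
    and immersion: "\<And>x w. x \<in> sphere 0 1 \<Longrightarrow> w \<bullet> x = 0 \<Longrightarrow> blinfun_apply (f' x) w = 0 \<Longrightarrow> w = 0"
begin

abbreviation S where "S \<equiv> sphere (0::'a) 1"

section \<open>Uniform first-order estimates along the sphere\<close>

lemma continuous_on_f: "continuous_on S f"
  using deriv sphere_U by (meson continuous_at_imp_continuous_on has_derivative_continuous subsetD)

lemma continuous_on_f': "continuous_on S f'"
  using cont_deriv sphere_U continuous_on_subset by blast

lemma continuous_on_f'_apply [continuous_intros]:
  "continuous_on A p \<Longrightarrow> p ` A \<subseteq> S \<Longrightarrow> continuous_on A w \<Longrightarrow> continuous_on A (\<lambda>z. f' (p z) (w z))"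
  by (intro continuous_intros continuous_on_compose2[OF continuous_on_f'])

text \<open>The mean value inequality for \<open>f - f' x\<close>, whose derivative
  \<open>f' z - f' x\<close> is small by uniform continuity of \<open>f'\<close>.\<close>

lemma strict_derivative:
  assumes "e > 0"
  shows "\<exists>d>0. \<forall>x\<in>S. \<forall>y\<in>S. dist x y < d \<longrightarrow> norm (f y - f x - f' x (y - x)) \<le> e * norm (y - x)"
proof -
  \<comment> \<open>Chords leave the sphere, so the estimate is made on balls around its points,
    inside a compact neighbourhood contained in \<open>U\<close>.\<close>
  obtain r where r: "r > 0" "(\<Union>x\<in>S. cball x r) \<subseteq> U"
    using compact_subset_open_imp_cball_epsilon_subset[OF compact_sphere open_U sphere_U] by blast
  let ?K = "(\<Union>x\<in>S. cball x r)"
  have K: "compact ?K"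
  proof -
    have "?K = (\<lambda>(x, v). x + v) ` (S \<times> cball 0 r)"
    proof (intro equalityI subsetI)
      fix z assume "z \<in> ?K"
      then obtain x where "x \<in> S" "norm (x - z) \<le> r" by (auto simp: dist_norm)
      then have "(x, z - x) \<in> S \<times> cball 0 r" by (simp add: norm_minus_commute)
      then show "z \<in> (\<lambda>(x, v). x + v) ` (S \<times> cball 0 r)" by (metis (mono_tags) add.commute case_prod_conv diff_add_cancel image_eqI)
    next
      fix z assume "z \<in> (\<lambda>(x, v). x + v) ` (S \<times> cball 0 r)"
      then obtain x v where "x \<in> S" "norm v \<le> r" "z = x + v" by auto
      then show "z \<in> ?K" by (intro UN_I[of x]) (auto simp: dist_norm)
    qed
    then show ?thesis
      by (auto intro!: compact_continuous_image compact_Times continuous_intros simp: case_prod_unfold)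
  qed
  have "uniformly_continuous_on ?K f'"
    using K r(2) cont_deriv by (intro compact_uniformly_continuous) (auto intro: continuous_on_subset)
  then obtain d where d: "d > 0" "\<And>x z. x \<in> ?K \<Longrightarrow> z \<in> ?K \<Longrightarrow> dist z x < d \<Longrightarrow> dist (f' z) (f' x) < e"
    unfolding uniformly_continuous_on_def using assms by metis
  have "norm (f y - f x - f' x (y - x)) \<le> e * norm (y - x)"
    if x: "x \<in> S" and y: "y \<in> S" and xy: "dist x y < min d r" for x y
  proof -
    let ?g = "\<lambda>z. f z - f' x z"
    have "norm (?g y - ?g x) \<le> e * norm (y - x)"
    proof (rule differentiable_bound[of "ball x (min d r)"])
      fix z assume z: "z \<in> ball x (min d r)"
      then have zK: "z \<in> ?K" using x by (intro UN_I[of x]) auto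
      then have "z \<in> U" using r(2) by blast
      then show "(?g has_derivative blinfun_apply (f' z - f' x)) (at z within ball x (min d r))"
        by (auto intro!: derivative_eq_intros has_derivative_at_withinI[OF deriv] simp: blinfun.diff_left)
      have "x \<in> ?K" using x r(1) by force
      moreover have "dist z x < d" using z by (simp add: dist_commute)
      ultimately have "dist (f' z) (f' x) < e" using d(2) zK by blast
      then show "onorm (blinfun_apply (f' z - f' x)) \<le> e"
        by (simp add: dist_norm flip: norm_blinfun.rep_eq)
    qed (use xy d r in auto)
    then show ?thesis by (simp add: blinfun.diff_right algebra_simps)
  qed
  then show ?thesis using d(1) r(1) by (intro exI[of _ "min d r"]) auto
qed

lemma f'_bound: obtains M where "M > 0" "\<And>x w. x \<in> S \<Longrightarrow> norm (f' x w) \<le> M * norm w"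
proof -
  have "bounded (f' ` S)"
    by (intro compact_imp_bounded compact_continuous_image continuous_on_f' compact_sphere)
  then obtain M where M: "M > 0" "\<And>x. x \<in> S \<Longrightarrow> norm (f' x) \<le> M" by (auto simp: bounded_pos)
  have "norm (f' x w) \<le> M * norm w" if "x \<in> S" for x w
    using norm_blinfun[of "f' x" w] mult_right_mono[OF M(2)[OF that], of "norm w"] by simp
  then show ?thesis using that M by blast
qed

lemma compact_unit_tangents: "compact {(x, w). x \<in> S \<and> norm w = 1 \<and> w \<bullet> x = 0}"
proof -
  have "{(x, w). x \<in> S \<and> norm w = 1 \<and> w \<bullet> x = 0} = (S \<times> S) \<inter> {p. snd p \<bullet> fst p = 0}" by auto
  also have "compact \<dots>"
    by (intro compact_Int_closed compact_Times compact_sphere closed_Collect_eq continuous_intros)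
  finally show ?thesis .
qed

text \<open>The minimum over the compact set of unit tangents is positive because \<open>f\<close>
  is an immersion.\<close>

lemma f'_lower_bound: obtains m where "m > 0" "\<And>x w. x \<in> S \<Longrightarrow> w \<bullet> x = 0 \<Longrightarrow> m * norm w \<le> norm (f' x w)"
proof -
  let ?T = "{(x, w). x \<in> S \<and> norm w = 1 \<and> w \<bullet> x = 0}"
  have cont: "continuous_on ?T (\<lambda>(x, w). norm (f' x w))"
    unfolding case_prod_unfold by (intro continuous_intros) auto
  obtain m where m: "m > 0" "\<And>x w. (x, w) \<in> ?T \<Longrightarrow> m \<le> norm (f' x w)"
  proof (cases "?T = {}")
    \<comment> \<open>In dimension 1 there are no unit tangents, and any positive \<open>m\<close>
      will do.\<close>
    case True
    then show ?thesis using that[of 1] by auto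
  next
    case False
    from continuous_attains_inf[OF compact_unit_tangents False cont]
    obtain p where p: "p \<in> ?T"
      "\<And>q. q \<in> ?T \<Longrightarrow> (case p of (x, w) \<Rightarrow> norm (f' x w)) \<le> (case q of (x, w) \<Rightarrow> norm (f' x w))" by blast
    obtain x0 w0 where "p = (x0, w0)" by (cases p)
    with p have "(x0, w0) \<in> ?T" "\<And>x w. (x, w) \<in> ?T \<Longrightarrow> norm (f' x0 w0) \<le> norm (f' x w)" by force+
    then show ?thesis using that[of "norm (f' x0 w0)"] immersion[of x0 w0] by force
  qed
  have "m * norm w \<le> norm (f' x w)" if "x \<in> S" "w \<bullet> x = 0" for x w
  proof (cases "w = 0")
    case False
    then have "m \<le> norm (f' x (w /\<^sub>R norm w))" using that by (intro m) auto
    then show ?thesis using False by (simp add: blinfun.scaleR_right field_simps)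
  qed simp
  then show ?thesis using that m(1) by blast
qed

text \<open>For unit \<open>x\<close>, the orthogonal projection to the tangent hyperplane at
  \<open>x\<close>. As \<open>x\<close> projects to 0, this is also the tangential part of the chord
  \<open>y - x\<close>.\<close>

definition tangential :: "'a \<Rightarrow> 'a \<Rightarrow> 'a" where
  "tangential x y = y - (y \<bullet> x) *\<^sub>R x"

lemma tangential_orthogonal: "x \<in> S \<Longrightarrow> tangential x y \<bullet> x = 0"
  by (simp add: tangential_def inner_diff_left norm_eq_1)

text \<open>The remaining part is the multiple of \<open>x\<close> by
  \<open>y \<bullet> x - 1\<close>, and the squared chord length is
  \<open>2 - 2 * (y \<bullet> x)\<close>.\<close>

lemma chord_minus_tangential:
  assumes "x \<in> S" "y \<in> S" shows "norm (y - x - tangential x y) = (norm (y - x))\<^sup>2 / 2"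
proof -
  have n: "x \<bullet> x = 1" "y \<bullet> y = 1" using assms by (auto simp: norm_eq_1)
  then have *: "(norm (y - x))\<^sup>2 = 2 - 2 * (y \<bullet> x)"
    by (simp add: power2_norm_eq_inner inner_diff_left inner_diff_right inner_commute)
  have "y - x - tangential x y = (y \<bullet> x - 1) *\<^sub>R x" by (simp add: tangential_def algebra_simps)
  then have "norm (y - x - tangential x y) = \<bar>y \<bullet> x - 1\<bar>" using assms by simp
  moreover have "y \<bullet> x \<le> 1" using * by (smt (verit) zero_le_power2)
  ultimately show ?thesis using * by simp
qed

text \<open>Dropping the normal part of the chord costs a second-order error; with \<open>f'\<close>
  bounded by \<open>M\<close>, distance below \<open>e / M\<close> keeps it within half of the
  allowance.\<close>

lemma tangential_approx:
  assumes "e > 0"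
  obtains d where "d > 0" "\<And>x y. x \<in> S \<Longrightarrow> y \<in> S \<Longrightarrow> dist x y < d \<Longrightarrow>
    norm (f y - f x - f' x (tangential x y)) \<le> e * norm (y - x)"
proof -
  obtain d where d: "d > 0" "\<And>x y. x \<in> S \<Longrightarrow> y \<in> S \<Longrightarrow> dist x y < d \<Longrightarrow>
      norm (f y - f x - f' x (y - x)) \<le> (e/2) * norm (y - x)"
    using strict_derivative[of "e/2"] assms by auto
  obtain M where M: "M > 0" "\<And>x w. x \<in> S \<Longrightarrow> norm (f' x w) \<le> M * norm w" by (rule f'_bound) blast
  have "norm (f y - f x - f' x (tangential x y)) \<le> e * norm (y - x)"
    if x: "x \<in> S" and y: "y \<in> S" and xy: "dist x y < min d (e / M)" for x y
  proof -
    let ?r = "y - x - tangential x y"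
    have "norm (f' x ?r) \<le> M * (norm (y - x))\<^sup>2 / 2"
      using M(2)[OF x, of ?r] chord_minus_tangential[OF x y] by simp
    also have "\<dots> = (M * norm (y - x)) * norm (y - x) / 2" by (simp add: power2_eq_square)
    also have "\<dots> \<le> e * norm (y - x) / 2"
      using xy M(1) by (intro divide_right_mono mult_right_mono) (auto simp: dist_norm norm_minus_commute field_simps)
    finally have "norm (f' x ?r) \<le> (e/2) * norm (y - x)" by simp
    moreover have "norm (f y - f x - f' x (y - x)) \<le> (e/2) * norm (y - x)" using d(2) x y xy by simp
    moreover have "f y - f x - f' x (tangential x y) = (f y - f x - f' x (y - x)) + f' x ?r"
      by (simp add: blinfun.diff_right)
    ultimately show ?thesis
      using norm_triangle_ineq[of "f y - f x - f' x (y - x)" "f' x ?r"] by (simp add: algebra_simps)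
  qed
  then show ?thesis using that[of "min d (e / M)"] d(1) M(1) assms by auto
qed

text \<open>Within distance 1 the tangential part is at least half the chord, so \<open>f'\<close>
  stretches it to at least \<open>m/2\<close> times the chord; the approximation error takes away at
  most \<open>m/4\<close>.\<close>

lemma chord_lower_bound:
  obtains k d where "k > 0" "d > 0" "\<And>x y. x \<in> S \<Longrightarrow> y \<in> S \<Longrightarrow> dist x y < d \<Longrightarrow> k * norm (y - x) \<le> norm (f y - f x)"
proof -
  obtain m where m: "m > 0" "\<And>x w. x \<in> S \<Longrightarrow> w \<bullet> x = 0 \<Longrightarrow> m * norm w \<le> norm (f' x w)"
    by (rule f'_lower_bound) blast
  obtain d where d: "d > 0" "\<And>x y. x \<in> S \<Longrightarrow> y \<in> S \<Longrightarrow> dist x y < d \<Longrightarrow>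
    norm (f y - f x - f' x (tangential x y)) \<le> (m/4) * norm (y - x)"
    using tangential_approx[of "m/4"] m(1) by auto
  have "m/4 * norm (y - x) \<le> norm (f y - f x)"
    if x: "x \<in> S" and y: "y \<in> S" and xy: "dist x y < min d 1" for x y
  proof -
    have "norm (y - x) * norm (y - x) \<le> norm (y - x) * 1"
      using xy by (intro mult_left_mono) (auto simp: dist_norm norm_minus_commute)
    then have "norm (y - x - tangential x y) \<le> norm (y - x) / 2"
      using chord_minus_tangential[OF x y] by (simp add: power2_eq_square)
    then have "norm (y - x) / 2 \<le> norm (tangential x y)"
      using norm_triangle_ineq2[of "y - x" "tangential x y"] by linarith
    then have "m * (norm (y - x) / 2) \<le> norm (f' x (tangential x y))"
      using m(1) m(2)[OF x tangential_orthogonal[OF x], of y] by (meson less_imp_le mult_left_mono order_trans)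
    moreover have "norm (f y - f x - f' x (tangential x y)) \<le> (m/4) * norm (y - x)" using d(2) x y xy by simp
    ultimately show ?thesis
      using norm_triangle_ineq2[of "f' x (tangential x y)" "f y - f x"] by (simp add: norm_minus_commute)
  qed
  then show ?thesis using that[of "m/4" "min d 1"] m(1) d(1) by auto
qed

section \<open>Unit normals\<close>

definition unit_normals :: "'a \<Rightarrow> 'a set" where
  "unit_normals x = {u. norm u = 1 \<and> (\<forall>w. w \<bullet> x = 0 \<longrightarrow> f' x w \<bullet> u = 0)}"

lemma uminus_unit_normals: "u \<in> unit_normals x \<Longrightarrow> - u \<in> unit_normals x"
  by (auto simp: unit_normals_def)

lemma tangent_space_dim:
  assumes "x \<in> S" shows "subspace (f' x ` {w. w \<bullet> x = 0})" "dim (f' x ` {w. w \<bullet> x = 0}) = DIM('a) - 1"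
proof -
  have sub: "subspace {w. w \<bullet> x = 0}" using subspace_hyperplane[of x] by (simp add: inner_commute)
  have lin: "linear (f' x)" by (simp add: blinfun.bounded_linear_right bounded_linear.linear)
  show "subspace (f' x ` {w. w \<bullet> x = 0})" using linear_subspace_image[OF lin sub] .
  have "inj_on (f' x) {w. w \<bullet> x = 0}"
    using immersion[OF assms] by (intro inj_onI) (metis (mono_tags, lifting) blinfun.diff_right eq_iff_diff_eq_0 inner_diff_left mem_Collect_eq)
  then have "dim (f' x ` {w. w \<bullet> x = 0}) = dim {w. w \<bullet> x = 0}"
    using sub by (intro dim_image_eq lin) (simp add: span_eq_iff[THEN iffD2])
  also have "\<dots> = DIM('a) - 1" using assms dim_hyperplane[of x] by (force simp: inner_commute)
  finally show "dim (f' x ` {w. w \<bullet> x = 0}) = DIM('a) - 1" .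
qed

lemma unit_normals_nonempty: assumes "x \<in> S" shows "unit_normals x \<noteq> {}"
proof -
  have "dim (f' x ` {w. w \<bullet> x = 0}) < DIM('a)" using tangent_space_dim[OF assms] by simp
  from orthogonal_to_subspace_exists[OF this] obtain u where "u \<noteq> 0"
    "\<And>y. y \<in> span (f' x ` {w. w \<bullet> x = 0}) \<Longrightarrow> orthogonal u y" by blast
  then have "u /\<^sub>R norm u \<in> unit_normals x"
    by (auto simp: unit_normals_def orthogonal_def inner_commute[of u] span_base)
  then show ?thesis by blast
qed

lemma tangent_space_eq:
  assumes "x \<in> S" "u \<in> unit_normals x" shows "f' x ` {w. w \<bullet> x = 0} = {z. z \<bullet> u = 0}"
proof (rule subspace_dim_equal)
  have "u \<noteq> 0" using assms(2) by (auto simp: unit_normals_def)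
  then show "dim {z. z \<bullet> u = 0} \<le> dim (f' x ` {w. w \<bullet> x = 0})"
    using tangent_space_dim(2)[OF assms(1)] dim_hyperplane[of u] by (simp add: inner_commute)
  show "subspace {z. z \<bullet> u = 0}" using subspace_hyperplane[of u] by (simp add: inner_commute)
qed (use assms tangent_space_dim in \<open>auto simp: unit_normals_def\<close>)

text \<open>The part of \<open>v\<close> orthogonal to \<open>u\<close> is a tangent vector by
  \<open>tangent_space_eq\<close>, hence orthogonal to \<open>v\<close> as well and so to
  itself.\<close>

lemma unit_normals_unique:
  assumes "x \<in> S" "u \<in> unit_normals x" "v \<in> unit_normals x" shows "v = u \<or> v = - u"
proof -
  have n: "u \<bullet> u = 1" "v \<bullet> v = 1" using assms by (auto simp: unit_normals_def norm_eq_1)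
  define z where "z = v - (v \<bullet> u) *\<^sub>R u"
  have "z \<bullet> u = 0" by (simp add: z_def inner_diff_left n)
  then have "z \<in> f' x ` {w. w \<bullet> x = 0}" using tangent_space_eq[OF assms(1,2)] by simp
  then have "z \<bullet> v = 0" using assms(3) by (auto simp: unit_normals_def)
  then have "z \<bullet> z = 0" using \<open>z \<bullet> u = 0\<close> by (subst (2) z_def) (simp add: inner_diff_right)
  then have v: "v = (v \<bullet> u) *\<^sub>R u" by (simp add: z_def)
  moreover have "norm v = 1" "norm u = 1" using assms by (auto simp: unit_normals_def)
  ultimately have "\<bar>v \<bullet> u\<bar> = 1" by (metis mult.right_neutral norm_scaleR)
  then have "v \<bullet> u = 1 \<or> v \<bullet> u = -1" by linarith
  then show ?thesis using v by (metis scaleR_minus1_left scaleR_one)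
qed

lemma compact_normal_bundle: "compact {(x, u). x \<in> S \<and> u \<in> unit_normals x}"
proof -
  let ?Z = "{(x, u). x \<in> S \<and> u \<in> unit_normals x}"
  \<comment> \<open>The tangent vectors at \<open>x\<close> vary with \<open>x\<close>; writing them
    as \<open>tangential x w\<close> with arbitrary \<open>w\<close> turns the condition into an
    intersection of closed ones.\<close>
  have eq: "?Z = (S \<times> S) \<inter> (\<Inter>w. {p \<in> S \<times> S. f' (fst p) (tangential (fst p) w) \<bullet> snd p = 0})" (is "_ = ?R")
  proof -
    have "unit_normals x = {u. norm u = 1 \<and> (\<forall>w. f' x (tangential x w) \<bullet> u = 0)}" if "x \<in> S" for x
      unfolding unit_normals_def
      using tangential_orthogonal[OF that] by (metis (no_types) diff_zero scaleR_zero_left tangential_def)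
    then show ?thesis by auto
  qed
  have "closed {p \<in> S \<times> S. f' (fst p) (tangential (fst p) w) \<bullet> snd p = 0}" for w
    unfolding tangential_def
    by (intro continuous_closed_preimage_constant continuous_intros closed_Times closed_sphere) auto
  then have "compact ?R" by (intro compact_Int_closed compact_Times compact_sphere closed_INT) auto
  then show ?thesis by (simp only: eq)
qed

text \<open>First variation: along each great circle through \<open>x\<close> the squared distance
  to \<open>z\<close> is minimal at \<open>x\<close>, so its derivative vanishes there in every
  tangent direction.\<close>

lemma nearest_point_normal:
  assumes x: "x \<in> S" and z: "z \<noteq> f x" and near: "\<And>y. y \<in> S \<Longrightarrow> dist z (f x) \<le> dist z (f y)"
  shows "(z - f x) /\<^sub>R norm (z - f x) \<in> unit_normals x"
proof -
  have xx: "x \<bullet> x = 1" using x by (auto simp: norm_eq_1)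
  have *: "f' x w \<bullet> (z - f x) = 0" if w: "w \<bullet> x = 0" "w \<bullet> w = 1" for w
  proof -
    define c where "c t = cos t *\<^sub>R x + sin t *\<^sub>R w" for t :: real
    have cS: "c t \<in> S" for t
    proof -
      have "c t \<bullet> c t = (cos t)\<^sup>2 + (sin t)\<^sup>2"
        using w xx by (simp add: c_def inner_add_left inner_add_right inner_commute power2_eq_square)
      then show ?thesis by (simp add: norm_eq_1)
    qed
    have c0: "c 0 = x" by (simp add: c_def)
    have dc: "(c has_derivative (\<lambda>t. t *\<^sub>R w)) (at 0)"
      unfolding c_def by (auto intro!: derivative_eq_intros)
    have dfc: "((\<lambda>t. f (c t)) has_derivative (\<lambda>t. f' x (t *\<^sub>R w))) (at 0)"
      using has_derivative_compose[OF dc, of f "f' x"] deriv[of x] sphere_U x c0 by auto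
    have d: "((\<lambda>t. (z - f (c t)) \<bullet> (z - f (c t))) has_derivative (\<lambda>t. - 2 * (f' x (t *\<^sub>R w) \<bullet> (z - f x)))) (at 0)"
      by (rule derivative_eq_intros dfc refl)+ (auto simp: c0 inner_commute)
    have "(z - f (c 0)) \<bullet> (z - f (c 0)) \<le> (z - f (c t)) \<bullet> (z - f (c t))" for t
      using near[OF cS[of t]] c0 by (simp add: dist_norm norm_le)
    then have "(\<lambda>t. - 2 * (f' x (t *\<^sub>R w) \<bullet> (z - f x))) = (\<lambda>v. 0)"
      by (intro differential_zero_maxmin[OF _ open_UNIV d]) auto
    from fun_cong[OF this, of 1] show ?thesis by simp
  qed
  have "f' x w \<bullet> (z - f x) = 0" if "w \<bullet> x = 0" for w
  proof (cases "w = 0")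
    case False
    then have "f' x (w /\<^sub>R norm w) \<bullet> (z - f x) = 0"
      using that by (intro *) (auto simp: dot_square_norm power2_eq_square)
    then show ?thesis using False by (simp add: blinfun.scaleR_right)
  qed simp
  then show ?thesis using z by (auto simp: unit_normals_def)
qed

end

section \<open>The outer normal of an embedded sphere\<close>

locale C1_embedded_sphere = C1_immersed_sphere f f' U for f :: "'a::euclidean_space \<Rightarrow> 'a" and f' U +
  assumes inj: "inj_on f (sphere 0 1)" and dim2: "2 \<le> DIM('a)"
begin

definition \<Sigma> where "\<Sigma> = f ` S"

lemma compact_\<Sigma>: "compact \<Sigma>"
  unfolding \<Sigma>_def by (intro compact_continuous_image continuous_on_f compact_sphere)

section \<open>Cones about the normals that miss the surface\<close>

lemma close_images_imp_close:
  assumes "d > 0"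
  obtains r where "r > 0" "\<And>x y. x \<in> S \<Longrightarrow> y \<in> S \<Longrightarrow> dist (f x) (f y) < r \<Longrightarrow> dist x y < d"
proof -
  \<comment> \<open>Injectivity enters here: the inverse of \<open>f\<close> on the compact image is
    uniformly continuous.\<close>
  have "\<exists>g. homeomorphism S \<Sigma> f g"
    by (rule homeomorphism_compact[OF compact_sphere continuous_on_f _ inj]) (simp add: \<Sigma>_def)
  then obtain g where g: "homeomorphism S \<Sigma> f g" by blast
  then have "uniformly_continuous_on \<Sigma> g"
    by (intro compact_uniformly_continuous compact_\<Sigma>) (auto simp: homeomorphism_def)
  then obtain r where "r > 0" "\<And>p q. p \<in> \<Sigma> \<Longrightarrow> q \<in> \<Sigma> \<Longrightarrow> dist q p < r \<Longrightarrow> dist (g q) (g p) < d"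
    unfolding uniformly_continuous_on_def using assms by metis
  moreover have "g (f x) = x" "f x \<in> \<Sigma>" if "x \<in> S" for x using g that by (auto simp: homeomorphism_def)
  ultimately show ?thesis using that[of r] by metis
qed

text \<open>A truncated cone about a unit vector \<open>u\<close> without its apex: \<open>c\<close>
  bounds the cosine of the angle with \<open>u\<close> from below, \<open>t\<close> bounds the
  length.\<close>

definition cone :: "real \<Rightarrow> real \<Rightarrow> 'a \<Rightarrow> 'a set" where
  "cone c t u = {v. v \<noteq> 0 \<and> norm v \<le> t \<and> c * norm v \<le> v \<bullet> u}"

definition cone_free :: "real \<Rightarrow> real \<Rightarrow> bool" where
  "cone_free c t \<longleftrightarrow> (\<forall>x\<in>S. \<forall>u\<in>unit_normals x. \<forall>v\<in>cone c t u. f x + v \<notin> \<Sigma>)"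

text \<open>A surface point close to \<open>f x\<close> comes from a parameter \<open>y\<close>
  close to \<open>x\<close>. The chord is then nearly tangent, so its component along a normal is
  too small for the cone.\<close>

lemma cone_free_exists:
  assumes "c > 0" obtains t where "t > 0" "cone_free c t"
proof -
  obtain k d1 where kd: "k > 0" "d1 > 0" "\<And>x y. x \<in> S \<Longrightarrow> y \<in> S \<Longrightarrow> dist x y < d1 \<Longrightarrow> k * norm (y - x) \<le> norm (f y - f x)"
    by (rule chord_lower_bound) blast
  \<comment> \<open>With this tolerance and the lower bound \<open>k\<close>, the normal component
    of a chord is at most half of \<open>c\<close> times its length.\<close>
  obtain d2 where d2: "d2 > 0" "\<And>x y. x \<in> S \<Longrightarrow> y \<in> S \<Longrightarrow> dist x y < d2 \<Longrightarrow>
    norm (f y - f x - f' x (tangential x y)) \<le> (c * k / 2) * norm (y - x)"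
    using tangential_approx[of "c * k / 2"] assms kd(1) by auto
  obtain r where r: "r > 0" "\<And>x y. x \<in> S \<Longrightarrow> y \<in> S \<Longrightarrow> dist (f x) (f y) < r \<Longrightarrow> dist x y < min d1 d2"
    using close_images_imp_close[of "min d1 d2"] kd(2) d2(1) by (metis min_less_iff_conj)
  have "f x + v \<notin> \<Sigma>" if x: "x \<in> S" and u: "u \<in> unit_normals x" and v: "v \<in> cone c (r/2) u" for x u v
  proof
    assume "f x + v \<in> \<Sigma>"
    then obtain y where y: "y \<in> S" "f y = f x + v" by (auto simp: \<Sigma>_def)
    have v': "v \<noteq> 0" "norm v \<le> r / 2" "c * norm v \<le> v \<bullet> u" using v by (auto simp: cone_def)
    then have "dist (f x) (f y) < r" using r(1) y(2) by (simp add: dist_norm)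
    then have xy: "dist x y < d1" "dist x y < d2" using r(2)[OF x y(1)] by auto
    have "y \<noteq> x" using y(2) v' by auto
    have "f' x (tangential x y) \<bullet> u = 0"
      using u tangential_orthogonal[OF x] by (auto simp: unit_normals_def)
    then have "v \<bullet> u = (f y - f x - f' x (tangential x y)) \<bullet> u" using y(2) by (simp add: inner_diff_left)
    also have "\<dots> \<le> norm (f y - f x - f' x (tangential x y)) * norm u" by (rule norm_cauchy_schwarz)
    also have "\<dots> \<le> (c * k / 2) * norm (y - x)" using d2(2)[OF x y(1) xy(2)] u by (auto simp: unit_normals_def)
    finally have "c * norm v \<le> (c * k / 2) * norm (y - x)" using v'(3) by simp
    moreover have "c * (k * norm (y - x)) \<le> c * norm v"
      using kd(3)[OF x y(1) xy(1)] y(2) assms by simp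
    ultimately have "c * k * norm (y - x) \<le> 0" by simp
    then show False using \<open>y \<noteq> x\<close> assms kd(1) by (simp add: mult_le_0_iff)
  qed
  then show ?thesis using that[of "r/2"] r(1) by (auto simp: cone_free_def)
qed

lemma outside_segment:
  assumes "z \<in> outside \<Sigma>" "closed_segment z z' \<inter> \<Sigma> = {}" shows "z' \<in> outside \<Sigma>"
proof -
  have "connected_component (- \<Sigma>) z z'"
    using assms(2) by (intro connected_componentI[of "closed_segment z z'"]) auto
  then show ?thesis using outside_same_component assms(1) by blast
qed

text \<open>Removing the apex does no harm: all vectors of the cone have positive inner product with
  \<open>u\<close>, so no convex combination is 0.\<close>

lemma convex_cone: assumes "c > 0" shows "convex (cone c t u)"
proof -
  have "r *\<^sub>R v + s *\<^sub>R w \<in> cone c t u"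
    if v: "v \<in> cone c t u" and w: "w \<in> cone c t u" and rs: "0 \<le> r" "0 \<le> s" "r + s = 1" for v w r s
  proof -
    have n: "norm (r *\<^sub>R v + s *\<^sub>R w) \<le> r * norm v + s * norm w"
      using norm_triangle_ineq[of "r *\<^sub>R v" "s *\<^sub>R w"] rs by simp
    have "r * norm v + s * norm w \<le> t"
      using v w rs convex_bound_le[of "norm v" t "norm w" r s] by (auto simp: cone_def)
    have i: "c * (r * norm v + s * norm w) \<le> (r *\<^sub>R v + s *\<^sub>R w) \<bullet> u"
    proof -
      have "r * (c * norm v) + s * (c * norm w) \<le> r * (v \<bullet> u) + s * (w \<bullet> u)"
        using v w rs by (intro add_mono mult_left_mono) (auto simp: cone_def)
      then show ?thesis by (simp add: inner_add_left algebra_simps)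
    qed
    have "0 < r * norm v + s * norm w"
    proof (cases "r = 0")
      case False
      then show ?thesis using v w rs by (intro add_pos_nonneg mult_pos_pos) (auto simp: cone_def)
    qed (use w rs in \<open>auto simp: cone_def\<close>)
    then have "0 < (r *\<^sub>R v + s *\<^sub>R w) \<bullet> u" using i assms by (smt (verit) mult_pos_pos)
    then have "r *\<^sub>R v + s *\<^sub>R w \<noteq> 0" by auto
    moreover have "c * norm (r *\<^sub>R v + s *\<^sub>R w) \<le> (r *\<^sub>R v + s *\<^sub>R w) \<bullet> u"
      using order_trans[OF mult_left_mono[OF n] i] assms by simp
    ultimately show ?thesis using n \<open>r * norm v + s * norm w \<le> t\<close> by (simp add: cone_def)
  qed
  then show ?thesis unfolding convex_def by blast
qed

text \<open>The translated cone is convex and misses \<open>\<Sigma>\<close>, so segments within it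
  stay in one component of the complement.\<close>

lemma cone_same_side:
  assumes "c > 0" "cone_free c t" "x \<in> S" "u \<in> unit_normals x" "v \<in> cone c t u" "w \<in> cone c t u"
    and "f x + v \<in> outside \<Sigma>"
  shows "f x + w \<in> outside \<Sigma>"
proof (rule outside_segment[OF assms(7)])
  have "closed_segment v w \<subseteq> cone c t u" by (intro closed_segment_subset convex_cone assms)
  moreover have "closed_segment (f x + v) (f x + w) = (+) (f x) ` closed_segment v w"
    by (rule closed_segment_translation)
  ultimately show "closed_segment (f x + v) (f x + w) \<inter> \<Sigma> = {}"
    using assms(2-4) by (fastforce simp: cone_free_def)
qed

lemma normal_in_cone: "0 < s \<Longrightarrow> s \<le> t \<Longrightarrow> c \<le> 1 \<Longrightarrow> u \<in> unit_normals x \<Longrightarrow> s *\<^sub>R u \<in> cone c t u"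
  by (auto simp: cone_def unit_normals_def dot_square_norm)

section \<open>The two sides of the surface\<close>

lemma closed_\<Sigma>: "closed \<Sigma>" using compact_\<Sigma> compact_imp_closed by blast

text \<open>Otherwise the complement would be the connected outside, against Jordan-Brouwer
  separation.\<close>

lemma inside_nonempty: "inside \<Sigma> \<noteq> {}"
proof
  assume "inside \<Sigma> = {}"
  then have "outside \<Sigma> = - \<Sigma>" using inside_Un_outside[of \<Sigma>] by blast
  then have "connected (- \<Sigma>)" using connected_outside[of \<Sigma>] compact_\<Sigma> dim2 by (auto simp: compact_imp_bounded)
  moreover have "\<Sigma> homeomorphic sphere (0::'a) 1"
    using homeomorphic_compact[OF compact_sphere continuous_on_f _ inj] homeomorphic_sym by (force simp: \<Sigma>_def)
  ultimately show False using Jordan_Brouwer_separation[of \<Sigma> 0 1] by auto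
qed

lemma outside_nonempty: "outside \<Sigma> \<noteq> {}"
  using outside_bounded_nonempty[of \<Sigma>] compact_\<Sigma> compact_imp_bounded by blast

text \<open>A point of \<open>D\<close> close to the frontier has a nearest surface point, and is
  reached from it along a normal by \<open>nearest_point_normal\<close>.\<close>

lemma approach_along_normal:
  assumes "t > 0" and "D = inside \<Sigma> \<or> D = outside \<Sigma>"
  obtains x u s where "x \<in> S" "u \<in> unit_normals x" "0 < s" "s \<le> t" "f x + s *\<^sub>R u \<in> D"
proof -
  have D: "D \<noteq> {}" "D \<noteq> UNIV" "frontier D \<subseteq> \<Sigma>" "D \<inter> \<Sigma> = {}"
    using assms(2) inside_nonempty outside_nonempty inside_Int_outside[of \<Sigma>]
      frontier_inside_subset[OF closed_\<Sigma>] frontier_outside_subset[OF closed_\<Sigma>]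
      inside_no_overlap[of \<Sigma>] outside_no_overlap[of \<Sigma>] by blast+
  obtain p where p: "p \<in> frontier D" using frontier_not_empty D by blast
  then have "p \<in> closure D" by (simp add: frontier_def)
  then obtain z where z: "z \<in> D" "dist z p < t" using assms(1) closure_approachable by blast
  have pG: "p \<in> \<Sigma>" using p D by blast
  obtain q where q: "q \<in> \<Sigma>" "\<And>y. y \<in> \<Sigma> \<Longrightarrow> dist z q \<le> dist z y"
    using distance_attains_inf[OF closed_\<Sigma>, of z] pG by blast
  then obtain x where x: "x \<in> S" "q = f x" by (auto simp: \<Sigma>_def)
  have zq: "z \<noteq> f x" using z D q x by auto
  show ?thesis
  proof (rule that[OF x(1)])
    show "(z - f x) /\<^sub>R norm (z - f x) \<in> unit_normals x"
      using q x zq by (intro nearest_point_normal) (auto simp: \<Sigma>_def)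
    show "0 < norm (z - f x)" using zq by simp
    show "norm (z - f x) \<le> t" using q(2)[OF pG] z(2) x(2) by (simp add: dist_norm)
    show "f x + norm (z - f x) *\<^sub>R ((z - f x) /\<^sub>R norm (z - f x)) \<in> D" using zq z(1) by simp
  qed
qed

lemma closed_sides: "closed (inside \<Sigma> \<union> \<Sigma>)" "closed (outside \<Sigma> \<union> \<Sigma>)"
proof -
  have "inside \<Sigma> \<union> \<Sigma> = - outside \<Sigma>" "outside \<Sigma> \<union> \<Sigma> = - inside \<Sigma>"
    using inside_Un_outside[of \<Sigma>] inside_Int_outside[of \<Sigma>] by blast+
  then show "closed (inside \<Sigma> \<union> \<Sigma>)" "closed (outside \<Sigma> \<union> \<Sigma>)"
    using open_inside[OF closed_\<Sigma>] open_outside[OF closed_\<Sigma>] by (simp_all add: closed_def)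
qed

lemma compact_normals_into:
  assumes "closed D" shows "compact {(x, u). x \<in> S \<and> u \<in> unit_normals x \<and> f x + s *\<^sub>R u \<in> D}"
proof -
  let ?Z = "{(x, u). x \<in> S \<and> u \<in> unit_normals x}"
  have "continuous_on ?Z (\<lambda>p. f (fst p) + s *\<^sub>R snd p)"
    by (intro continuous_intros continuous_on_compose2[OF continuous_on_f]) force
  then have "closed (?Z \<inter> (\<lambda>p. f (fst p) + s *\<^sub>R snd p) -` D)"
    by (rule continuous_closed_preimage[OF _ compact_imp_closed[OF compact_normal_bundle] assms])
  then have "compact (?Z \<inter> (?Z \<inter> (\<lambda>p. f (fst p) + s *\<^sub>R snd p) -` D))"
    by (rule compact_Int_closed[OF compact_normal_bundle])
  also have "?Z \<inter> (?Z \<inter> (\<lambda>p. f (fst p) + s *\<^sub>R snd p) -` D) =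
      {(x, u). x \<in> S \<and> u \<in> unit_normals x \<and> f x + s *\<^sub>R u \<in> D}" by auto
  finally show ?thesis .
qed

text \<open>The points of \<open>S\<close> whose two normal directions lead outside and outside, inside and inside, or
  outside and inside form three disjoint closed sets. The first two cannot be all of \<open>S\<close>, since both
  sides of \<open>\<Sigma>\<close> are reached along a normal.\<close>
lemma opposite_sides:
  assumes c: "0 < c" "c \<le> 1" and t: "t > 0" "cone_free c t" and x: "x \<in> S"
  shows "\<exists>u\<in>unit_normals x. f x + t *\<^sub>R u \<in> outside \<Sigma> \<and> f x - t *\<^sub>R u \<in> inside \<Sigma>"
proof -
  \<comment> \<open>\<open>Q s D\<close> collects the normals whose tip at signed height
    \<open>s\<close> lies in \<open>D\<close>; \<open>P D D'\<close> collects the base points with a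
    normal leading into \<open>D\<close> forwards and into \<open>D'\<close> backwards.\<close>
  define Q where "Q s D = {(x, u). x \<in> S \<and> u \<in> unit_normals x \<and> f x + s *\<^sub>R u \<in> D}" for s D
  define P where "P D D' = fst ` (Q t D \<inter> Q (- t) D')" for D D'
  let ?I = "inside \<Sigma>" and ?O = "outside \<Sigma>"
  have uc: "s *\<^sub>R u \<in> cone c t u" if "x \<in> S" "u \<in> unit_normals x" "0 < s" "s \<le> t" for x u s
    using normal_in_cone c that by blast
  have free: "f x + t *\<^sub>R u \<notin> \<Sigma>" "f x - t *\<^sub>R u \<notin> \<Sigma>" if "x \<in> S" "u \<in> unit_normals x" for x u
    using t(2) that uc[of x u t] uc[of x "- u" t] uminus_unit_normals[of u x] t(1)
    by (fastforce simp: cone_free_def)+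
  have closed_P: "closed (P D D')" if "D = ?I \<or> D = ?O" "D' = ?I \<or> D' = ?O" for D D'
  proof -
    \<comment> \<open>The tips lie in cones free of \<open>\<Sigma>\<close>, so each side may be
      replaced by its union with \<open>\<Sigma>\<close>, which is closed.\<close>
    have Q: "Q t D = Q t (D \<union> \<Sigma>)" "Q (- t) D' = Q (- t) (D' \<union> \<Sigma>)" using free by (auto simp: Q_def)
    have "closed (D \<union> \<Sigma>)" "closed (D' \<union> \<Sigma>)" using that closed_sides by blast+
    then have "compact (Q t (D \<union> \<Sigma>))" "compact (Q (- t) (D' \<union> \<Sigma>))"
      unfolding Q_def by (simp_all only: compact_normals_into)
    then have "compact (Q t (D \<union> \<Sigma>) \<inter> Q (- t) (D' \<union> \<Sigma>))" by (rule compact_Int)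
    then have "compact (P D D')"
      unfolding P_def Q by (intro compact_continuous_image continuous_on_fst continuous_on_id)
    then show ?thesis by (rule compact_imp_closed)
  qed
  have cases: "f x + t *\<^sub>R u \<in> ?I \<or> f x + t *\<^sub>R u \<in> ?O" "f x - t *\<^sub>R u \<in> ?I \<or> f x - t *\<^sub>R u \<in> ?O"
    if "x \<in> S" "u \<in> unit_normals x" for x u
    using free[OF that] inside_Un_outside[of \<Sigma>] by blast+
  have mem: "x \<in> P D D' \<longleftrightarrow> x \<in> S \<and> (\<exists>u\<in>unit_normals x. f x + t *\<^sub>R u \<in> D \<and> f x - t *\<^sub>R u \<in> D')" for x D D'
  proof -
    have "x \<in> P D D' \<longleftrightarrow> (\<exists>u. (x, u) \<in> Q t D \<inter> Q (- t) D')"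
      by (auto simp: P_def intro: rev_image_eqI)
    then show ?thesis by (auto simp: Q_def)
  qed
  have cover: "S \<subseteq> P ?O ?O \<union> P ?I ?I \<union> P ?O ?I"
  proof
    fix x assume x: "x \<in> S"
    obtain u where u: "u \<in> unit_normals x" using unit_normals_nonempty[OF x] by blast
    \<comment> \<open>Replacing \<open>u\<close> by \<open>- u\<close> turns inside-outside into
      outside-inside, so three classes cover \<open>S\<close>.\<close>
    have "f x + t *\<^sub>R (- u) = f x - t *\<^sub>R u" "f x - t *\<^sub>R (- u) = f x + t *\<^sub>R u" by auto
    then show "x \<in> P ?O ?O \<union> P ?I ?I \<union> P ?O ?I"
      using cases[OF x u] x u uminus_unit_normals[OF u] unfolding Un_iff mem by metis
  qed
  have all: "f x + t *\<^sub>R v \<in> D" if "x \<in> P D D" "v \<in> unit_normals x" for x v D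
    using that unit_normals_unique[of x _ v] unfolding mem by (metis add_uminus_conv_diff scaleR_minus_right)
  have disj: "P ?O ?O \<inter> (P ?I ?I \<union> P ?O ?I) = {}" "P ?I ?I \<inter> P ?O ?I = {}"
  proof -
    have "False" if "x \<in> P ?O ?O" "x \<in> P D ?I" for x D
    proof -
      from that(2) obtain u where "u \<in> unit_normals x" "f x - t *\<^sub>R u \<in> ?I" unfolding mem by blast
      moreover then have "f x + t *\<^sub>R (- u) \<in> ?O" by (intro all[OF that(1)] uminus_unit_normals)
      ultimately show False using disjoint_iff[THEN iffD1, OF inside_Int_outside[of \<Sigma>]] by simp
    qed
    then show "P ?O ?O \<inter> (P ?I ?I \<union> P ?O ?I) = {}" by blast
    have "False" if "x \<in> P ?I ?I" "x \<in> P ?O ?I" for x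
    proof -
      from that(2) obtain u where "u \<in> unit_normals x" "f x + t *\<^sub>R u \<in> ?O" unfolding mem by blast
      then show False using all[OF that(1), of u] inside_Int_outside[of \<Sigma>] by blast
    qed
    then show "P ?I ?I \<inter> P ?O ?I = {}" by blast
  qed
  have conn: "connected S" using dim2 by (intro connected_sphere)
  have not_all: "\<not> S \<subseteq> P ?O ?O" "\<not> S \<subseteq> P ?I ?I"
  proof
    assume *: "S \<subseteq> P ?O ?O"
    obtain x u s where s: "x \<in> S" "u \<in> unit_normals x" "0 < s" "s \<le> t" "f x + s *\<^sub>R u \<in> ?I"
      using approach_along_normal[OF t(1), of ?I] by blast
    then have "f x + t *\<^sub>R u \<in> ?O" using * all by blast
    \<comment> \<open>Heights \<open>s\<close> and \<open>t\<close> on one normal belong to the same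
      cone, hence to the same side.\<close>
    then have "f x + s *\<^sub>R u \<in> ?O"
      using cone_same_side[OF c(1) t(2) s(1,2) uc uc] s t(1) by blast
    then show False using s(5) inside_Int_outside[of \<Sigma>] by blast
  next
    show "\<not> S \<subseteq> P ?I ?I"
    proof
      assume *: "S \<subseteq> P ?I ?I"
      obtain x u s where s: "x \<in> S" "u \<in> unit_normals x" "0 < s" "s \<le> t" "f x + s *\<^sub>R u \<in> ?O"
        using approach_along_normal[OF t(1), of ?O] by blast
      then have "f x + t *\<^sub>R u \<in> ?O"
        using cone_same_side[OF c(1) t(2) s(1,2) uc uc] t(1) by blast
      moreover have "f x + t *\<^sub>R u \<in> ?I" using * all s by blast
      ultimately show False using inside_Int_outside[of \<Sigma>] by blast
    qed
  qed
  have sub: "P D D' \<subseteq> S" for D D' using mem by blast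
  have split: "A = {} \<or> B = {}" if "closed A" "closed B" "S \<subseteq> A \<union> B" "A \<inter> B = {}" "A \<subseteq> S" "B \<subseteq> S" for A B
  proof -
    have "A \<inter> S = {} \<or> B \<inter> S = {}"
      using connected_closedD[OF conn _ that(3,1,2)] that(4) by auto
    then show ?thesis using that(5,6) by blast
  qed
  \<comment> \<open>Connectedness is used twice, first to exclude outside-outside, then
    inside-inside.\<close>
  have "P ?O ?O = {} \<or> P ?I ?I \<union> P ?O ?I = {}"
    by (intro split closed_Un closed_P disj(1) Un_least sub) (use cover in auto)
  then have "P ?O ?O = {}" using cover not_all(1) by blast
  moreover then have "P ?I ?I = {} \<or> P ?O ?I = {}"
    by (intro split closed_P disj(2) sub) (use cover in auto)
  ultimately have "P ?O ?O = {}" "P ?I ?I = {}" using cover not_all(2) by blast+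
  then have "x \<in> P ?O ?I" using cover x by blast
  then show ?thesis using mem by blast
qed

text \<open>By \<open>opposite_sides\<close> exactly one of the two unit normals leads outside, so
  the graph of \<open>\<nu>\<close> is cut out of the compact normal bundle by a closed
  condition.\<close>

lemma outer_normal:
  assumes c: "0 < c" "c \<le> 1" and t: "t > 0" "cone_free c t"
  obtains \<nu> where "continuous_on S \<nu>" "\<And>x. x \<in> S \<Longrightarrow> \<nu> x \<in> unit_normals x"
    "\<And>x. x \<in> S \<Longrightarrow> f x + t *\<^sub>R \<nu> x \<in> outside \<Sigma>" "\<And>x. x \<in> S \<Longrightarrow> f x - t *\<^sub>R \<nu> x \<in> inside \<Sigma>"
proof -
  obtain \<nu> where \<nu>: "\<And>x. x \<in> S \<Longrightarrow> \<nu> x \<in> unit_normals x"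
    "\<And>x. x \<in> S \<Longrightarrow> f x + t *\<^sub>R \<nu> x \<in> outside \<Sigma>" "\<And>x. x \<in> S \<Longrightarrow> f x - t *\<^sub>R \<nu> x \<in> inside \<Sigma>"
    using opposite_sides[OF c t] by metis
  let ?G = "{(x, u). x \<in> S \<and> u \<in> unit_normals x \<and> f x + t *\<^sub>R u \<in> outside \<Sigma> \<union> \<Sigma>}"
  have "continuous_on S \<nu>"
  proof (rule continuous_on_image_compact_graph)
    show "compact ?G" by (intro compact_normals_into closed_sides)
    fix x u assume x: "x \<in> S"
    have "u = \<nu> x" if u: "u \<in> unit_normals x" "f x + t *\<^sub>R u \<in> outside \<Sigma> \<union> \<Sigma>"
    proof (rule ccontr)
      assume "u \<noteq> \<nu> x"
      then have "u = - \<nu> x" using unit_normals_unique[OF x \<nu>(1)[OF x] u(1)] by blast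
      then have "f x + t *\<^sub>R u \<in> inside \<Sigma>" using \<nu>(3)[OF x] by simp
      with u(2) show False using inside_Int_outside[of \<Sigma>] inside_no_overlap[of \<Sigma>] by blast
    qed
    then show "(x, u) \<in> ?G \<longleftrightarrow> u = \<nu> x" using \<nu>(1,2) x by auto
  qed auto
  then show ?thesis using that \<nu> by blast
qed

section \<open>The outer normal is not nullhomotopic\<close>

text \<open>Pairing a zero on the segment with \<open>a\<close> gives two nonnegative terms with sum
  0; this pushes the zero to the end \<open>b\<close>.\<close>

lemma zero_notin_closed_segment:
  fixes a b :: 'a
  assumes "a \<noteq> 0" "b \<noteq> 0" "0 \<le> a \<bullet> b" shows "0 \<notin> closed_segment a b"
proof
  assume "0 \<in> closed_segment a b"
  then obtain r where r: "0 \<le> r" "r \<le> 1" "0 = (1 - r) *\<^sub>R a + r *\<^sub>R b" by (auto simp: closed_segment_def)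
  then have "(1 - r) * (a \<bullet> a) + r * (a \<bullet> b) = 0" by (metis inner_add_right inner_scaleR_right inner_zero_right)
  moreover have "0 \<le> (1 - r) * (a \<bullet> a)" "0 \<le> r * (a \<bullet> b)" using r assms by auto
  ultimately have "(1 - r) * (a \<bullet> a) = 0" by linarith
  then have "r = 1" using assms(1) by simp
  then show False using r(3) assms(2) by simp
qed

section \<open>Great circles and chords of the embedding\<close>

definition great_circle :: "'a \<Rightarrow> 'a \<Rightarrow> real \<Rightarrow> 'a" where
  "great_circle x e s = cos s *\<^sub>R x + sin s *\<^sub>R e"

lemma great_circle:
  assumes "x \<in> S" "e \<in> S" "e \<bullet> x = 0"
  shows "great_circle x e s \<in> S" "great_circle x e s \<bullet> x = cos s"
    "tangential x (great_circle x e s) = sin s *\<^sub>R e" "0 \<le> s \<Longrightarrow> norm (great_circle x e s - x) \<le> s"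
proof -
  have n: "x \<bullet> x = 1" "e \<bullet> e = 1" "x \<bullet> e = 0" using assms by (auto simp: norm_eq_1 inner_commute)
  have "great_circle x e s \<bullet> great_circle x e s = (cos s)\<^sup>2 + (sin s)\<^sup>2"
    using n assms(3) by (simp add: great_circle_def inner_add_left inner_add_right power2_eq_square)
  then have gg: "great_circle x e s \<bullet> great_circle x e s = 1" by simp
  then show "great_circle x e s \<in> S" by (simp add: norm_eq_1)
  show gx: "great_circle x e s \<bullet> x = cos s" using n assms(3) by (simp add: great_circle_def inner_add_left)
  show "tangential x (great_circle x e s) = sin s *\<^sub>R e"
    unfolding tangential_def gx by (simp add: great_circle_def)
  assume s: "0 \<le> s"
  have "(norm (great_circle x e s - x))\<^sup>2 = 2 - 2 * cos s"
    using gx by (simp add: power2_norm_eq_inner inner_diff_left inner_diff_right gg n inner_commute)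
  also have "\<dots> = (2 * sin (s / 2))\<^sup>2" using cos_double_sin[of "s / 2"] by (simp add: power_mult_distrib)
  finally have "sqrt ((norm (great_circle x e s - x))\<^sup>2) = sqrt ((2 * sin (s / 2))\<^sup>2)" by (rule arg_cong)
  then have "norm (great_circle x e s - x) = \<bar>2 * sin (s / 2)\<bar>"
    by (simp only: real_sqrt_abs abs_norm_cancel)
  also have "\<dots> \<le> s" using abs_sin_x_le_abs_x[of "s / 2"] s by simp
  finally show "norm (great_circle x e s - x) \<le> s" .
qed

text \<open>The chord over a short arc is \<open>sin s\<close> times \<open>f' x e\<close> plus an
  error of length at most \<open>m * sin s\<close>, too short to make the inner product
  negative.\<close>

lemma small_chords:
  obtains s where "0 < s" "s < pi" "\<And>x e. x \<in> S \<Longrightarrow> e \<in> S \<Longrightarrow> e \<bullet> x = 0 \<Longrightarrow>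
    0 \<le> f' x e \<bullet> (f (great_circle x e s) - f x)"
proof -
  obtain m where m: "m > 0" "\<And>x w. x \<in> S \<Longrightarrow> w \<bullet> x = 0 \<Longrightarrow> m * norm w \<le> norm (f' x w)"
    by (rule f'_lower_bound) blast
  obtain d where d: "d > 0" "\<And>x y. x \<in> S \<Longrightarrow> y \<in> S \<Longrightarrow> dist x y < d \<Longrightarrow>
    norm (f y - f x - f' x (tangential x y)) \<le> (m/2) * norm (y - x)"
    using tangential_approx[of "m/2"] m(1) by auto
  define s where "s = min 1 (d / 2)"
  have s: "0 < s" "s \<le> 1" "s < d" "s < pi" using d(1) pi_gt3 by (auto simp: s_def)
  have sin_pos: "sin s > 0" using s by (intro sin_gt_zero) auto
  have "0 \<le> f' x e \<bullet> (f (great_circle x e s) - f x)" if x: "x \<in> S" and e: "e \<in> S" "e \<bullet> x = 0" for x e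
  proof -
    let ?y = "great_circle x e s"
    note gc = great_circle[OF x e, of s]
    have ny: "norm (?y - x) \<le> s" using gc(4) s by simp
    \<comment> \<open>For chords of length at most 1 the tangential part, of length
      \<open>sin s\<close>, is at least half the chord.\<close>
    then have "norm (?y - x) * norm (?y - x) \<le> norm (?y - x) * 1"
      using s by (intro mult_left_mono) auto
    then have "norm (?y - x - sin s *\<^sub>R e) \<le> norm (?y - x) / 2"
      using chord_minus_tangential[OF x gc(1)] gc(3) by (simp add: power2_eq_square)
    then have ny2: "norm (?y - x) \<le> 2 * sin s"
      using norm_triangle_ineq2[of "?y - x" "sin s *\<^sub>R e"] e(1) sin_pos by simp
    let ?r = "f ?y - f x - f' x (sin s *\<^sub>R e)"
    have "norm ?r \<le> (m/2) * norm (?y - x)"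
      using d(2)[OF x gc(1)] gc(3) ny s by (simp add: dist_norm norm_minus_commute)
    also have "\<dots> \<le> (m/2) * (2 * sin s)" using m(1) ny2 by (intro mult_left_mono) auto
    finally have r: "norm ?r \<le> m * sin s" by simp
    have me: "m \<le> norm (f' x e)" using m(2)[OF x e(2)] e(1) by simp
    have "\<bar>f' x e \<bullet> ?r\<bar> \<le> norm (f' x e) * (m * sin s)"
      using Cauchy_Schwarz_ineq2[of "f' x e" ?r] mult_left_mono[OF r, of "norm (f' x e)"] by simp
    also have "\<dots> \<le> norm (f' x e) * (norm (f' x e) * sin s)"
      using me sin_pos by (intro mult_left_mono mult_right_mono) auto
    also have "\<dots> = sin s * (f' x e \<bullet> f' x e)" by (simp add: dot_square_norm power2_eq_square)
    finally have "0 \<le> sin s * (f' x e \<bullet> f' x e) + f' x e \<bullet> ?r" by linarith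
    also have "\<dots> = f' x e \<bullet> (f ?y - f x)"
      by (simp add: blinfun.scaleR_right inner_diff_right)
    finally show ?thesis .
  qed
  with that s show ?thesis by blast
qed

text \<open>A vector orthogonal to the normal is tangent and has a unique tangent preimage, so
  continuity follows from compactness of the graph.\<close>

lemma continuous_tangent_lift:
  assumes u: "continuous_on S u" and orth: "\<And>x. x \<in> S \<Longrightarrow> u x \<bullet> \<nu> x = 0"
    and \<nu>: "\<And>x. x \<in> S \<Longrightarrow> \<nu> x \<in> unit_normals x"
  obtains w where "continuous_on S w" "\<And>x. x \<in> S \<Longrightarrow> w x \<bullet> x = 0" "\<And>x. x \<in> S \<Longrightarrow> f' x (w x) = u x"
proof -
  have "\<exists>w. w \<bullet> x = 0 \<and> f' x w = u x" if "x \<in> S" for x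
    using tangent_space_eq[OF that \<nu>[OF that]] orth[OF that] by (metis (mono_tags, lifting) imageE mem_Collect_eq)
  then obtain w where w: "\<And>x. x \<in> S \<Longrightarrow> w x \<bullet> x = 0" "\<And>x. x \<in> S \<Longrightarrow> f' x (w x) = u x" by metis
  obtain m where m: "m > 0" "\<And>x w. x \<in> S \<Longrightarrow> w \<bullet> x = 0 \<Longrightarrow> m * norm w \<le> norm (f' x w)"
    by (rule f'_lower_bound) blast
  have "bounded (u ` S)" by (intro compact_imp_bounded compact_continuous_image u compact_sphere)
  then obtain B where B: "\<And>x. x \<in> S \<Longrightarrow> norm (u x) \<le> B" by (meson bounded_iff imageI)
  \<comment> \<open>The lower bound \<open>m\<close> confines every \<open>w x\<close> to this ball,
    which makes the graph bounded.\<close>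
  let ?C = "S \<times> cball (0::'a) (B / m)"
  let ?G = "?C \<inter> {p \<in> ?C. snd p \<bullet> fst p = 0} \<inter> {p \<in> ?C. f' (fst p) (snd p) - u (fst p) = 0}"
  have "continuous_on S w"
  proof (rule continuous_on_image_compact_graph)
    show "compact ?G"
      by (intro compact_Int_closed compact_Times compact_sphere compact_cball
          continuous_closed_preimage_constant continuous_intros closed_Times closed_sphere closed_cball
          continuous_on_compose2[OF u]) auto
    fix x v assume x: "x \<in> S"
    have "norm (w x) \<le> B / m"
      using m(2)[OF x w(1)[OF x]] B[OF x] w(2)[OF x] m(1) by (simp add: pos_le_divide_eq mult.commute)
    moreover have "v = w x" if "v \<bullet> x = 0" "f' x v = u x"
      using immersion[OF x, of "v - w x"] that w[OF x] by (simp add: inner_diff_left blinfun.diff_right)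
    ultimately show "(x, v) \<in> ?G \<longleftrightarrow> v = w x" using x w by auto
  qed auto
  with that w show ?thesis by blast
qed

text \<open>Let the arc grow from \<open>s\<close> to \<open>pi\<close>, where it ends at
  \<open>- x\<close>. Its end never returns to \<open>x\<close>, so injectivity of \<open>f\<close>
  keeps the chord nonzero.\<close>

lemma homotopic_great_circle:
  assumes e: "continuous_on S e" "e ` S \<subseteq> S" "\<And>x. x \<in> S \<Longrightarrow> e x \<bullet> x = 0" and s: "0 < s" "s < pi"
  shows "homotopic_with_canon (\<lambda>_. True) S (- {0})
    (\<lambda>x. f (great_circle x (e x) s) - f x) (\<lambda>x. f (- x) - f x)"
proof -
  define h where "h p = f (great_circle (snd p) (e (snd p)) (s + fst p * (pi - s))) - f (snd p)" for p
  have cont: "continuous_on ({0..1} \<times> S) h"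
    unfolding h_def
  proof (intro continuous_intros continuous_on_compose2[OF continuous_on_f])
    show "continuous_on ({0..1} \<times> S) (\<lambda>p. great_circle (snd p) (e (snd p)) (s + fst p * (pi - s)))"
      unfolding great_circle_def by (intro continuous_intros continuous_on_compose2[OF e(1)]) auto
    show "(\<lambda>p. great_circle (snd p) (e (snd p)) (s + fst p * (pi - s))) ` ({0..1} \<times> S) \<subseteq> S"
      using great_circle(1) e by (auto simp: image_subset_iff)
  qed auto
  have nz: "h (r, x) \<noteq> 0" if r: "0 \<le> r" "r \<le> 1" and x: "x \<in> S" for r x
  proof
    assume "h (r, x) = 0"
    let ?s = "s + r * (pi - s)"
    have eS: "e x \<in> S" using e(2) x by blast
    note gc = great_circle[OF x eS e(3)[OF x], of ?s]
    have "great_circle x (e x) ?s = x"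
      using inj_onD[OF inj _ gc(1) x] \<open>h (r, x) = 0\<close> by (simp add: h_def)
    then have "cos ?s = 1" using gc(2) x by (simp add: norm_eq_1)
    moreover have "0 < ?s" "?s \<le> pi"
    proof -
      show "0 < ?s" using r s by (intro add_pos_nonneg) auto
      show "?s \<le> pi" using r s mult_left_le_one_le[of "pi - s" r] by linarith
    qed
    then have "cos ?s < cos 0" by (intro cos_monotone_0_pi) auto
    ultimately show False by simp
  qed
  show ?thesis
    unfolding homotopic_with_def
    by (rule exI[of _ h]) (use cont nz in \<open>auto simp: h_def great_circle_def\<close>)
qed

text \<open>In the chain from \<open>\<nu>\<close> to the full chord, the first two links are linear
  homotopies between nonzero vectors with nonnegative inner product; the third is
  \<open>homotopic_great_circle\<close>.\<close>

lemma normal_field_essential: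
  assumes \<nu>: "continuous_on S \<nu>" "\<And>x. x \<in> S \<Longrightarrow> \<nu> x \<in> unit_normals x"
    and hom: "homotopic_with_canon (\<lambda>_. True) S (- {0}) \<nu> (\<lambda>x. c)"
  shows False
proof -
  let ?n = "\<lambda>y::'a. y /\<^sub>R norm y"
  have "homotopic_with_canon (\<lambda>_. True) S S (?n \<circ> \<nu>) (?n \<circ> (\<lambda>x. c))"
    by (rule homotopic_with_compose_continuous_left[OF hom]) (auto intro!: continuous_intros)
  then have "homotopic_with_canon (\<lambda>_. True) S S \<nu> (\<lambda>x. ?n c)"
    by (rule homotopic_with_eq) (use \<nu> in \<open>auto simp: unit_normals_def\<close>)
  then obtain u where u: "continuous_on S u" "u ` S \<subseteq> S" "\<And>x. x \<in> S \<Longrightarrow> u x \<bullet> \<nu> x = 0"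
    using nullhomotopic_imp_orthogonal_field[OF compact_sphere dim2] by blast
  obtain w where w: "continuous_on S w" "\<And>x. x \<in> S \<Longrightarrow> w x \<bullet> x = 0" "\<And>x. x \<in> S \<Longrightarrow> f' x (w x) = u x"
    using continuous_tangent_lift[OF u(1,3) \<nu>(2)] by blast
  have w0: "w x \<noteq> 0" if "x \<in> S" for x
    using w(3)[OF that] u(2) that by (force simp: image_subset_iff)
  define e where "e x = w x /\<^sub>R norm (w x)" for x
  have e: "continuous_on S e" "e ` S \<subseteq> S" "\<And>x. x \<in> S \<Longrightarrow> e x \<bullet> x = 0"
    using w0 w(2) unfolding e_def by (auto intro!: continuous_intros w(1))
  have e0: "f' x (e x) \<noteq> 0" if "x \<in> S" for x
    using immersion[OF that e(3)[OF that]] e(2) that by (force simp: image_subset_iff)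
  have fe: "continuous_on S (\<lambda>x. f' x (e x))" by (intro continuous_intros e(1)) auto
  obtain s where s: "0 < s" "s < pi" "\<And>x e. x \<in> S \<Longrightarrow> e \<in> S \<Longrightarrow> e \<bullet> x = 0 \<Longrightarrow>
    0 \<le> f' x e \<bullet> (f (great_circle x e s) - f x)" by (rule small_chords) blast
  have gc: "homotopic_with_canon (\<lambda>_. True) S (- {0})
    (\<lambda>x. f (great_circle x (e x) s) - f x) (\<lambda>x. f (- x) - f x)"
    by (rule homotopic_great_circle[OF e s(1,2)])
  have h1: "homotopic_with_canon (\<lambda>_. True) S (- {0}) \<nu> (\<lambda>x. f' x (e x))"
  proof (intro homotopic_with_linear \<nu>(1) fe)
    fix x assume x: "x \<in> S"
    have "\<nu> x \<bullet> f' x (e x) = 0" "\<nu> x \<noteq> 0"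
      using \<nu>(2)[OF x] e(3)[OF x] by (auto simp: unit_normals_def inner_commute)
    then show "closed_segment (\<nu> x) (f' x (e x)) \<subseteq> - {0}"
      using zero_notin_closed_segment[of "\<nu> x" "f' x (e x)"] e0[OF x] by auto
  qed
  have h2: "homotopic_with_canon (\<lambda>_. True) S (- {0}) (\<lambda>x. f' x (e x)) (\<lambda>x. f (great_circle x (e x) s) - f x)"
  proof (intro homotopic_with_linear fe)
    show "continuous_on S (\<lambda>x. f (great_circle x (e x) s) - f x)"
      using homotopic_with_imp_continuous[OF gc] by simp
    fix x assume x: "x \<in> S"
    have "f (great_circle x (e x) s) - f x \<noteq> 0"
      using homotopic_with_imp_subset1[OF gc] x by (auto simp: image_subset_iff)
    moreover have "0 \<le> f' x (e x) \<bullet> (f (great_circle x (e x) s) - f x)"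
      using s(3)[OF x _ e(3)[OF x]] e(2) x by blast
    ultimately show "closed_segment (f' x (e x)) (f (great_circle x (e x) s) - f x) \<subseteq> - {0}"
      using zero_notin_closed_segment[OF e0[OF x]] by auto
  qed
  have "homotopic_with_canon (\<lambda>_. True) S (- {0}) (\<lambda>x. f (- x) - f x) (\<lambda>x. c)"
    by (rule homotopic_with_trans[OF homotopic_with_symD hom])
      (rule homotopic_with_trans[OF h1 homotopic_with_trans[OF h2 gc]])
  then show False by (rule odd_map_not_nullhomotopic[rotated]) simp
qed

section \<open>Inscribed simplices\<close>

definition signed_dist :: "'a \<Rightarrow> real" where
  "signed_dist z = (if z \<in> outside \<Sigma> then infdist z \<Sigma> else - infdist z \<Sigma>)"

text \<open>Both formulas vanish on \<open>\<Sigma>\<close>, so they glue over the two closed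
  sides.\<close>

lemma continuous_signed_dist: "continuous_on UNIV signed_dist"
proof -
  have "continuous_on ((outside \<Sigma> \<union> \<Sigma>) \<union> (inside \<Sigma> \<union> \<Sigma>)) signed_dist"
    unfolding signed_dist_def
  proof (rule continuous_on_cases[OF closed_sides(2,1)])
    have "infdist z \<Sigma> = - infdist z \<Sigma>" if "z \<in> \<Sigma>" for z using that by simp
    moreover have "z \<in> \<Sigma>" if "z \<in> outside \<Sigma> \<union> \<Sigma> \<and> z \<notin> outside \<Sigma> \<or> z \<in> inside \<Sigma> \<union> \<Sigma> \<and> z \<in> outside \<Sigma>" for z
      using that inside_Int_outside[of \<Sigma>] by blast
    ultimately show "\<forall>z. z \<in> outside \<Sigma> \<union> \<Sigma> \<and> z \<notin> outside \<Sigma> \<or> z \<in> inside \<Sigma> \<union> \<Sigma> \<and> z \<in> outside \<Sigma>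
      \<longrightarrow> infdist z \<Sigma> = - infdist z \<Sigma>" by blast
  qed (intro continuous_intros)+
  moreover have "(outside \<Sigma> \<union> \<Sigma>) \<union> (inside \<Sigma> \<union> \<Sigma>) = UNIV" using inside_Un_outside[of \<Sigma>] by blast
  ultimately show ?thesis by simp
qed

lemma signed_dist_0_iff: "signed_dist z = 0 \<longleftrightarrow> z \<in> \<Sigma>"
  using in_closed_iff_infdist_zero[OF closed_\<Sigma>, of z] by (auto simp: signed_dist_def \<Sigma>_def)

lemma signed_dist_pos_iff: "signed_dist z > 0 \<longleftrightarrow> z \<in> outside \<Sigma>"
  using signed_dist_0_iff[of z] infdist_nonneg[of z \<Sigma>] disjoint_iff[THEN iffD1, OF outside_no_overlap[of \<Sigma>]]
  by (auto simp: signed_dist_def less_le split: if_splits)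

text \<open>The base vertex is \<open>f x\<close>. The other edge vectors are indexed by
  \<open>Basis\<close>, so that one number for each of them makes up a vector of the same space, and
  \<open>indep\<close> says that they span it.\<close>

lemma inscribed_homothet:
  fixes w :: "'a \<Rightarrow> 'a"
  assumes indep: "\<And>u. (\<And>j. j \<in> Basis \<Longrightarrow> u \<bullet> w j = 0) \<Longrightarrow> u = 0"
  shows "\<exists>x\<in>S. \<exists>r>0. \<forall>j\<in>Basis. f x + r *\<^sub>R w j \<in> \<Sigma>"
proof (rule ccontr)
  assume none: "\<not> (\<exists>x\<in>S. \<exists>r>0. \<forall>j\<in>Basis. f x + r *\<^sub>R w j \<in> \<Sigma>)"
  define L where "L u = (\<Sum>j\<in>Basis. (u \<bullet> w j) *\<^sub>R j)" for u
  have L_inner: "L u \<bullet> j = u \<bullet> w j" if "j \<in> Basis" for u j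
    using that by (simp add: L_def inner_sum_left_Basis)
  have lin: "linear L"
    by (rule linearI) (simp_all add: L_def inner_add_left scaleR_add_left sum.distrib scaleR_sum_right)
  have inj_L: "inj L"
  proof -
    have "u = 0" if "L u = 0" for u using indep[of u] L_inner[of _ u] that by simp
    then show ?thesis using lin linear_injective_0 by blast
  qed
  obtain B where B: "B > 0" "\<And>u. B * norm u \<le> norm (L u)"
    using linear_inj_bounded_below_pos[OF lin inj_L] by metis
  \<comment> \<open>The sum bounds each \<open>norm (w j)\<close>; the added 1 makes
    \<open>W\<close> positive and gives the strict inequality \<open>k * (W - 1) < B\<close> used
    for \<open>steep\<close>.\<close>
  define W where "W = 1 + (\<Sum>j\<in>Basis. norm (w j))"
  have W: "W > 0" "\<And>j. j \<in> Basis \<Longrightarrow> norm (w j) \<le> W"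
  proof -
    show "W > 0" unfolding W_def by (intro add_pos_nonneg sum_nonneg) auto
    show "norm (w j) \<le> W" if "j \<in> Basis" for j
      using member_le_sum[OF that, of "\<lambda>j. norm (w j)"] by (simp add: W_def)
  qed
  define k where "k = min 1 (B / W)"
  have k: "0 < k" "k \<le> 1" "k * W \<le> B" using B W by (auto simp: k_def min_def field_simps)
  \<comment> \<open>Each unit vector makes with some edge, up to sign, an angle of cosine at least
    \<open>k\<close>. For \<open>u = \<nu> x\<close> this edge points into a cone about
    \<open>\<nu> x\<close> or \<open>- \<nu> x\<close>.\<close>
  have steep: "\<exists>j\<in>Basis. w j \<noteq> 0 \<and> k * norm (w j) \<le> \<bar>u \<bullet> w j\<bar>" if u: "norm u = 1" for u
  proof (rule ccontr)
    assume "\<not> ?thesis"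
    then have "\<bar>u \<bullet> w j\<bar> \<le> k * norm (w j)" if "j \<in> Basis" for j using that by (cases "w j = 0") force+
    then have "(\<Sum>j\<in>Basis. \<bar>L u \<bullet> j\<bar>) \<le> (\<Sum>j\<in>Basis. k * norm (w j))"
      by (intro sum_mono) (simp add: L_inner)
    then have "norm (L u) \<le> k * (W - 1)"
      using norm_le_l1[of "L u"] by (simp add: W_def sum_distrib_left)
    then show False using B(2)[of u] u k by (simp add: algebra_simps)
  qed
  obtain t where t: "t > 0" "cone_free k t" using cone_free_exists[OF k(1)] by blast
  obtain \<nu> where \<nu>: "continuous_on S \<nu>" "\<And>x. x \<in> S \<Longrightarrow> \<nu> x \<in> unit_normals x"
    "\<And>x. x \<in> S \<Longrightarrow> f x + t *\<^sub>R \<nu> x \<in> outside \<Sigma>" "\<And>x. x \<in> S \<Longrightarrow> f x - t *\<^sub>R \<nu> x \<in> inside \<Sigma>"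
    using outer_normal[OF k(1,2) t] by blast
  \<comment> \<open>A zero of \<open>H r\<close> at \<open>x\<close> is exactly a homothet of ratio
    \<open>r\<close> inscribed with base vertex \<open>f x\<close>.\<close>
  define H where "H r x = (\<Sum>j\<in>Basis. signed_dist (f x + r *\<^sub>R w j) *\<^sub>R j)" for r x
  have H_inner: "H r x \<bullet> j = signed_dist (f x + r *\<^sub>R w j)" if "j \<in> Basis" for r x j
    using that by (simp add: H_def inner_sum_left_Basis)
  have H_nz: "H r x \<noteq> 0" if "r > 0" "x \<in> S" for r x
  proof
    assume "H r x = 0"
    then have "f x + r *\<^sub>R w j \<in> \<Sigma>" if "j \<in> Basis" for j
      using H_inner[OF that, of r x] signed_dist_0_iff by simp
    then show False using none \<open>r > 0\<close> \<open>x \<in> S\<close> by blast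
  qed
  have H_cont: "continuous_on S (H r)" for r
    unfolding H_def
    by (intro continuous_intros continuous_on_compose2[OF continuous_signed_dist] continuous_on_f) auto
  \<comment> \<open>Small enough that every \<open>r *\<^sub>R w j\<close> respects the cone length
    \<open>t\<close>.\<close>
  define r where "r = t / W"
  have r: "r > 0" using t W by (simp add: r_def)
  have r_le: "norm (r *\<^sub>R w j) \<le> t" if "j \<in> Basis" for j
    using W(2)[OF that] W(1) t(1) by (simp add: r_def field_simps)
  have same_sign: "0 \<notin> closed_segment a b" if "0 < (a \<bullet> j) * (b \<bullet> j)" for a b j :: 'a
  proof
    assume "0 \<in> closed_segment a b"
    then obtain q where q: "0 \<le> q" "q \<le> 1" "0 = (1 - q) *\<^sub>R a + q *\<^sub>R b" by (auto simp: closed_segment_def)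
    then have "(1 - q) * (a \<bullet> j) + q * (b \<bullet> j) = 0" by (metis inner_add_left inner_scaleR_left inner_zero_left)
    then have "(a \<bullet> j) * ((1 - q) * (a \<bullet> j) + q * (b \<bullet> j)) = 0" by simp
    then have "(1 - q) * ((a \<bullet> j) * (a \<bullet> j)) + q * ((a \<bullet> j) * (b \<bullet> j)) = 0"
      by (simp add: algebra_simps)
    moreover have "0 \<le> (1 - q) * ((a \<bullet> j) * (a \<bullet> j))" "0 \<le> q * ((a \<bullet> j) * (b \<bullet> j))" using q that by auto
    ultimately have "(1 - q) * ((a \<bullet> j) * (a \<bullet> j)) = 0" "q * ((a \<bullet> j) * (b \<bullet> j)) = 0" by linarith+
    then show False using that by auto
  qed
  have "homotopic_with_canon (\<lambda>_. True) S (- {0}) (\<lambda>x. L (\<nu> x)) (H r)"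
  proof (intro homotopic_with_linear H_cont)
    show "continuous_on S (\<lambda>x. L (\<nu> x))"
      unfolding L_def by (intro continuous_intros \<nu>(1))
    fix x assume x: "x \<in> S"
    have n: "norm (\<nu> x) = 1" using \<nu>(2)[OF x] by (simp add: unit_normals_def)
    obtain j where j: "j \<in> Basis" "w j \<noteq> 0" "k * norm (w j) \<le> \<bar>\<nu> x \<bullet> w j\<bar>" using steep[OF n] by blast
    have kw: "0 < k * norm (w j)" using k j by simp
    have in_cone: "r *\<^sub>R w j \<in> cone k t u" if "k * norm (w j) \<le> u \<bullet> w j" for u
    proof -
      have "r * (k * norm (w j)) \<le> r * (u \<bullet> w j)" using that r by (intro mult_left_mono) auto
      then show ?thesis using r_le[OF j(1)] r j(2) by (simp add: cone_def inner_commute algebra_simps)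
    qed
    \<comment> \<open>At the steep edge both vectors have a \<open>j\<close>-coordinate of the sign
      of \<open>\<nu> x \<bullet> w j\<close>: the vertex lies outside or inside with the normal
      whose cone contains the edge.\<close>
    have "0 < (L (\<nu> x) \<bullet> j) * (H r x \<bullet> j)"
    proof (cases "0 < \<nu> x \<bullet> w j")
      case True
      then have "r *\<^sub>R w j \<in> cone k t (\<nu> x)" using in_cone j(3) by simp
      then have "f x + r *\<^sub>R w j \<in> outside \<Sigma>"
        using cone_same_side[OF k(1) t(2) x \<nu>(2)[OF x] normal_in_cone[OF t(1) order_refl k(2) \<nu>(2)[OF x]] _ \<nu>(3)[OF x]]
        by blast
      then show ?thesis using True j(1) by (simp add: L_inner H_inner signed_dist_pos_iff)
    next
      case False
      then have c: "r *\<^sub>R w j \<in> cone k t (- \<nu> x)" "\<nu> x \<bullet> w j < 0" using j kw in_cone by auto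
      have m: "- \<nu> x \<in> unit_normals x" by (rule uminus_unit_normals[OF \<nu>(2)[OF x]])
      have "f x + r *\<^sub>R w j \<notin> \<Sigma>" using t(2) x m c(1) by (auto simp: cone_free_def)
      moreover have "f x + r *\<^sub>R w j \<notin> outside \<Sigma>"
      proof
        assume "f x + r *\<^sub>R w j \<in> outside \<Sigma>"
        then have "f x + t *\<^sub>R (- \<nu> x) \<in> outside \<Sigma>"
          using cone_same_side[OF k(1) t(2) x m c(1) normal_in_cone] m t(1) k(2) by blast
        then show False
          using \<nu>(4)[OF x] disjoint_iff[THEN iffD1, OF inside_Int_outside[of \<Sigma>]] by simp
      qed
      ultimately have "signed_dist (f x + r *\<^sub>R w j) < 0"
        using signed_dist_0_iff signed_dist_pos_iff by (metis linorder_neqE_linordered_idom)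
      then show ?thesis using c(2) j(1) by (simp add: L_inner H_inner mult_neg_neg)
    qed
    then show "closed_segment (L (\<nu> x)) (H r x) \<subseteq> - {0}" using same_sign by blast
  qed
  moreover
  obtain b :: 'a where b: "b \<in> Basis" "w b \<noteq> 0"
  proof -
    obtain z :: 'a where "norm z = 1" by (metis vector_choose_size zero_le_one)
    then show ?thesis using steep that by blast
  qed
  obtain \<rho> where \<rho>: "\<rho> > 0" "\<Sigma> \<subseteq> cball 0 \<rho>"
    using compact_imp_bounded[OF compact_\<Sigma>] by (auto simp: bounded_pos subset_iff)
  \<comment> \<open>Since \<open>norm (f x)\<close> is at most \<open>\<rho>\<close>, this puts the
    vertex along \<open>w b\<close> at norm at least \<open>2 * \<rho>\<close>, beyond the ball
    around \<open>\<Sigma>\<close>; the summand \<open>r\<close> ensures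
    \<open>R > r\<close>.\<close>
  define R where "R = 3 * \<rho> / norm (w b) + r"
  have R: "R > r" "R * norm (w b) \<ge> 3 * \<rho>"
    using \<rho>(1) b(2) r by (auto simp: R_def distrib_right)
  \<comment> \<open>Varying the ratio never meets 0, because no homothet is inscribed.\<close>
  have "homotopic_with_canon (\<lambda>_. True) S (- {0}) (H r) (H R)"
  proof -
    let ?h = "\<lambda>p. H (r + fst p * (R - r)) (snd p)"
    have "continuous_on ({0..1} \<times> S) ?h"
      unfolding H_def
      by (intro continuous_intros continuous_on_compose2[OF continuous_signed_dist]
          continuous_on_compose2[OF continuous_on_f]) auto
    moreover have "?h p \<in> - {0}" if "p \<in> {0..1} \<times> S" for p
    proof -
      have "0 < r + fst p * (R - r)" "snd p \<in> S"
        using that r R(1) by (auto intro!: add_pos_nonneg mult_nonneg_nonneg)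
      then show ?thesis using H_nz by simp
    qed
    ultimately show ?thesis
      unfolding homotopic_with_def by (intro exI[of _ ?h]) auto
  qed
  moreover have "homotopic_with_canon (\<lambda>_. True) S (- {0}) (H R) (\<lambda>x. b)"
  proof (intro homotopic_with_linear H_cont continuous_on_const)
    fix x assume x: "x \<in> S"
    have "f x \<in> cball 0 \<rho>" using \<rho>(2) x unfolding \<Sigma>_def by blast
    then have "norm (f x + R *\<^sub>R w b) > \<rho>"
      using norm_triangle_ineq2[of "R *\<^sub>R w b" "- f x"] R r \<rho>(1) by (simp add: add.commute)
    then have "f x + R *\<^sub>R w b \<in> outside \<Sigma>"
      using outside_subset_convex[OF convex_cball \<rho>(2)] by auto
    then have "0 < (H R x \<bullet> b) * (b \<bullet> b)" using b(1) by (simp add: H_inner signed_dist_pos_iff)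
    then show "closed_segment (H R x) b \<subseteq> - {0}" using same_sign by blast
  qed
  ultimately have hom: "homotopic_with_canon (\<lambda>_. True) S (- {0}) (\<lambda>x. L (\<nu> x)) (\<lambda>x. b)"
    using homotopic_with_trans by blast
  obtain g where g: "linear g" "\<And>y. g (L y) = y" "\<And>y. L (g y) = y"
    using linear_injective_isomorphism[OF lin inj_L] by auto
  \<comment> \<open>Undoing the linear isomorphism \<open>L\<close> turns the homotopy into one of
    \<open>\<nu>\<close> itself.\<close>
  have "homotopic_with_canon (\<lambda>_. True) S (- {0}) (g \<circ> (\<lambda>x. L (\<nu> x))) (g \<circ> (\<lambda>x. b))"
  proof (rule homotopic_with_compose_continuous_left[OF hom])
    show "continuous_on (- {0}) g" using g(1) by (simp add: linear_continuous_on linear_conv_bounded_linear)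
    have "g y \<noteq> 0" if "y \<noteq> 0" for y using g(3)[of y] that linear_0[OF lin] by auto
    then show "g \<in> - {0} \<rightarrow> - {0}" by auto
  qed
  then have "homotopic_with_canon (\<lambda>_. True) S (- {0}) \<nu> (\<lambda>x. g b)" by (simp add: o_def g(2))
  then show False using normal_field_essential \<nu>(1,2) by blast
qed

end

section \<open>From the inscribed vectors to the simplex\<close>

lemma affine_independent_no_common_normal:
  fixes v :: "nat \<Rightarrow> real^'n"
  assumes nonflat: "\<not> flat_simplex v" and orth: "\<And>i. i \<in> {1..CARD('n)} \<Longrightarrow> u \<bullet> (v i - v 0) = 0"
  shows "u = 0"
proof (rule ccontr)
  assume "u \<noteq> 0"
  \<comment> \<open>A common normal would put all vertices into this hyperplane, making the simplex
    flat.\<close>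
  let ?P = "{x. u \<bullet> x = u \<bullet> v 0}"
  have "aff_dim ?P = int CARD('n) - 1" using \<open>u \<noteq> 0\<close> aff_dim_hyperplane[of u "u \<bullet> v 0"] by simp
  moreover have "v i \<in> ?P" if "i \<le> CARD('n)" for i
    using orth[of i] that by (cases "i = 0") (auto simp: inner_diff_right)
  ultimately show False using nonflat affine_hyperplane[of u "u \<bullet> v 0"] unfolding flat_simplex_def by blast
qed

theorem theorem5p1:
  fixes \<Gamma> :: "(real^'n) set" and v :: "nat \<Rightarrow> real^'n"
  assumes "CARD('n) \<ge> 2" and "CARD('n) \<noteq> 4"
    and "jordan_C1_sphere \<Gamma>"
    and "\<not> flat_simplex v"
  shows "\<exists>\<tau> \<eta>. is_translation \<tau> \<and> is_pos_homothety \<eta> \<and>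
           (\<forall>i\<le>CARD('n). \<eta> (\<tau> (v i)) \<in> \<Gamma>)"
proof -
  obtain f :: "real^'n \<Rightarrow> real^'n" and f' U where f: "open U" "sphere 0 1 \<subseteq> U" "\<forall>x\<in>U. (f has_derivative blinfun_apply (f' x)) (at x)"
      "continuous_on U f'" "inj_on f (sphere 0 1)"
      "\<forall>x\<in>sphere 0 1. \<forall>w. w \<bullet> x = 0 \<and> blinfun_apply (f' x) w = 0 \<longrightarrow> w = 0"
    and \<Gamma>: "\<Gamma> = f ` sphere 0 1"
    using assms(3) unfolding jordan_C1_sphere_def by (elim exE conjE) (rule that; assumption)
  interpret C1_embedded_sphere f f' U
  proof unfold_locales
    show "2 \<le> DIM(real^'n)" using assms(1) by simp
  qed (use f in blast)+
  \<comment> \<open>The vertices other than \<open>v 0\<close> are reindexed by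
    \<open>Basis\<close>, as \<open>inscribed_homothet\<close> expects.\<close>
  have "card (Basis :: (real^'n) set) = card {1..CARD('n)}" by simp
  then obtain h :: "real^'n \<Rightarrow> nat" where h: "bij_betw h Basis {1..CARD('n)}"
    using finite_same_card_bij[OF finite_Basis finite_atLeastAtMost] by blast
  have "u = 0" if "\<And>j. j \<in> Basis \<Longrightarrow> u \<bullet> (v (h j) - v 0) = 0" for u
  proof (rule affine_independent_no_common_normal[OF assms(4)])
    fix i assume "i \<in> {1..CARD('n)}"
    then obtain j where "j \<in> Basis" "i = h j" using bij_betw_imp_surj_on[OF h] by blast
    then show "u \<bullet> (v i - v 0) = 0" using that by simp
  qed
  from inscribed_homothet[of "\<lambda>j. v (h j) - v 0", OF this]
  obtain x r where x: "x \<in> sphere 0 1" "r > 0" "\<And>j. j \<in> Basis \<Longrightarrow> f x + r *\<^sub>R (v (h j) - v 0) \<in> \<Gamma>"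
    unfolding \<Gamma> \<Sigma>_def by blast
  have "f x + r *\<^sub>R (v i - v 0) \<in> \<Gamma>" if "i \<le> CARD('n)" for i
  proof (cases "i = 0")
    case False
    then have "i \<in> h ` Basis" using bij_betw_imp_surj_on[OF h] that by simp
    then show ?thesis using x(3) by auto
  qed (use x in \<open>simp add: \<Gamma>\<close>)
  \<comment> \<open>Translate \<open>v 0\<close> to \<open>f x\<close>, then scale about
    \<open>f x\<close> with ratio \<open>r\<close>.\<close>
  moreover have "is_translation (\<lambda>z. z + (f x - v 0))" by (auto simp: is_translation_def)
  moreover have "is_pos_homothety (\<lambda>z. f x + r *\<^sub>R (z - f x))" using x(2) by (auto simp: is_pos_homothety_def)
  ultimately show ?thesis
    by (intro exI[of _ "\<lambda>z. z + (f x - v 0)"] exI[of _ "\<lambda>z. f x + r *\<^sub>R (z - f x)"]) simp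
qed

end
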